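(* Let $X$ be a complex Banach space, let $A$ be a bounded linear operator on $X$ with spectral radius $r(A)$, let $p>0$, and let $K\in\mathcal S_{p,\infty}^{(e)}(X)$. Set $C_p:=\dfrac{\ln(2)\,(p+1)^{p+1}}{2p^p}$ and $M_A(r):=\sup_{n\in\mathbb N_0}\dfrac{\|A^n\|}{r^n}$ for $r>r(A)$. Then $$ n_{A+K}(s)\leq C_p\left(\inf_{r(A)<r<s}\frac{s\,M_A(r)^p}{(s-r)^{p+1}}\right)\|K\|_{p,\infty}^p \qquad\text{for all } s>r(A). $$ In particular, $$ n_{A+K}(s)\leq 2^{p+1}C_p\,\frac{s\,M_A\!\left(\frac{s+r(A)}{2}\right)^p}{(s-r(A))^{p+1}}\,\|K\|_{p,\infty}^p \qquad\text{for all } s>r(A). $$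
   Context: Here $\mathbb N_0=\{0,1,2,\dots\}$ and $\mathbb N=\{1,2,\dots\}$. Entropy numbers: for a bounded linear operator $T$ on $X$ with closed unit ball $B_X$ and $n\in\mathbb N$, $e_n(T)$ is the infimum of all $\varepsilon>0$ for which there exist $q\le 2^{n-1}$ and $y_1,\dots,y_q\in X$ with $T(B_X)\subset\bigcup_{i=1}^q(\{y_i\}+\varepsilon B_X)$. For $p>0$, $\mathcal S_{p,\infty}^{(e)}(X)$ is the set of bounded operators $T$ on $X$ with $\|T\|_{p,\infty}:=\sup_{n\in\mathbb N} n^{1/p}e_n(T)<\infty$ (such operators are compact). The discrete spectrum of a bounded operator consists of all its isolated eigenvalues of finite algebraic multiplicity (discrete eigenvalues). The essential spectrum $\sigma_{ess}(A)$ is the set of $\lambda\in\mathbb C$ such that $\lambda-A$ is not a Fredholm operator. For $K$ compact and $s>0$ with $s>|\lambda|$ for all $\lambda\in\sigma_{ess}(A)$, $n_{A+K}(s)$ denotes the number of discrete eigenvalues $\lambda$ of $A+K$ with $|\lambda|>s$, each counted as many times as its algebraic multiplicity. *)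

theory Defs
  imports "HOL-Analysis.Analysis"
begin

text \<open>
  Complex Banach spaces, as real Banach spaces with a compatible complex scalar multiplication.
  The trivial space is included.
\<close>

class complex_banach = banach +
  fixes scaleC :: "complex \<Rightarrow> 'a \<Rightarrow> 'a"  (infixr "*\<^sub>C" 75)
  assumes scaleC_add_right: "c *\<^sub>C (x + y) = c *\<^sub>C x + c *\<^sub>C y"
    and scaleC_add_left: "(c + d) *\<^sub>C x = c *\<^sub>C x + d *\<^sub>C x"
    and scaleC_scaleC: "c *\<^sub>C (d *\<^sub>C x) = (c * d) *\<^sub>C x"
    and scaleC_of_real: "complex_of_real t *\<^sub>C x = t *\<^sub>R x"
    and norm_scaleC: "norm (c *\<^sub>C x) = cmod c * norm x"

global_interpretation complex_vector:
  vector_space "scaleC :: complex \<Rightarrow> 'a \<Rightarrow> 'a::complex_banach"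
proof
  show "1 *\<^sub>C x = x" for x :: 'a
    using scaleC_of_real[of 1 x] by simp
qed (simp_all add: scaleC_add_right scaleC_add_left scaleC_scaleC)

instantiation complex :: complex_banach
begin

definition scaleC_complex :: "complex \<Rightarrow> complex \<Rightarrow> complex" where
  "scaleC_complex c x = c * x"

instance
  by standard (simp_all add: scaleC_complex_def algebra_simps norm_mult scaleR_conv_of_real)

end

definition bounded_clinear :: "('a::complex_banach \<Rightarrow> 'a) \<Rightarrow> bool" where
  "bounded_clinear T \<longleftrightarrow> bounded_linear T \<and> (\<forall>c x. T (c *\<^sub>C x) = c *\<^sub>C T x)"

definition resolvent_set :: "('a::complex_banach \<Rightarrow> 'a) \<Rightarrow> complex set" where
  "resolvent_set T = {z. \<exists>R. bounded_clinear R \<and>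
     (\<forall>x. z *\<^sub>C R x - T (R x) = x) \<and> (\<forall>x. R (z *\<^sub>C x - T x) = x)}"

definition spectrum :: "('a::complex_banach \<Rightarrow> 'a) \<Rightarrow> complex set" where
  "spectrum T = - resolvent_set T"

text \<open>
  The spectrum is empty only on the trivial space; inserting \<open>0\<close> makes the radius \<open>0\<close>
  there and has no effect otherwise.
\<close>

definition spectral_radius :: "('a::complex_banach \<Rightarrow> 'a) \<Rightarrow> real" where
  "spectral_radius T = Sup (insert 0 (cmod ` spectrum T))"

definition eigenvalue :: "('a::complex_banach \<Rightarrow> 'a) \<Rightarrow> complex \<Rightarrow> bool" where
  "eigenvalue T z \<longleftrightarrow> (\<exists>x. x \<noteq> 0 \<and> T x = z *\<^sub>C x)"

definition root_space :: "('a::complex_banach \<Rightarrow> 'a) \<Rightarrow> complex \<Rightarrow> 'a set" where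
  "root_space T z = {x. \<exists>k. ((\<lambda>y. z *\<^sub>C y - T y) ^^ k) x = 0}"

definition finite_alg_mult :: "('a::complex_banach \<Rightarrow> 'a) \<Rightarrow> complex \<Rightarrow> bool" where
  "finite_alg_mult T z \<longleftrightarrow> (\<exists>B. finite B \<and> complex_vector.span B = root_space T z)"

text \<open>Meaningful only under \<open>finite_alg_mult\<close>: \<open>dim\<close> is \<open>0\<close> in infinite dimension.\<close>

definition alg_mult :: "('a::complex_banach \<Rightarrow> 'a) \<Rightarrow> complex \<Rightarrow> nat" where
  "alg_mult T z = complex_vector.dim (root_space T z)"

definition discrete_spectrum :: "('a::complex_banach \<Rightarrow> 'a) \<Rightarrow> complex set" where
  "discrete_spectrum T =
     {z. eigenvalue T z \<and> z isolated_in spectrum T \<and> finite_alg_mult T z}"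

text \<open>
  The count takes values in \<^typ>\<open>ennreal\<close>, where every sum converges, so that infinitely many
  eigenvalues give \<open>\<infinity>\<close>.
\<close>

definition eigenvalue_count :: "('a::complex_banach \<Rightarrow> 'a) \<Rightarrow> real \<Rightarrow> ennreal" where
  "eigenvalue_count T s =
     (\<Sum>\<^sub>\<infinity>z\<in>{z \<in> discrete_spectrum T. cmod z > s}. of_nat (alg_mult T z))"

definition entropy_number :: "nat \<Rightarrow> ('a::complex_banach \<Rightarrow> 'a) \<Rightarrow> real" where
  "entropy_number n T = Inf {\<epsilon>. \<epsilon> > 0 \<and>
     (\<exists>q y. q \<le> (2::nat) ^ (n - 1) \<and> T ` cball 0 1 \<subseteq> (\<Union>i\<in>{1..q}. cball (y i) \<epsilon>))}"

definition entropy_class :: "real \<Rightarrow> ('a::complex_banach \<Rightarrow> 'a) set" where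
  "entropy_class p = {T. bounded_clinear T \<and>
     bdd_above ((\<lambda>n. real n powr (1 / p) * entropy_number n T) ` {1..})}"

definition entropy_quasinorm :: "real \<Rightarrow> ('a::complex_banach \<Rightarrow> 'a) \<Rightarrow> real" where
  "entropy_quasinorm p T = (SUP n\<in>{1..}. real n powr (1 / p) * entropy_number n T)"

definition entropy_const :: "real \<Rightarrow> real" where
  "entropy_const p = ln 2 * (p + 1) powr (p + 1) / (2 * p powr p)"

text \<open>The supremum is finite for \<open>r > spectral_radius A\<close>, the only case of interest.\<close>

definition power_bound :: "('a::complex_banach \<Rightarrow> 'a) \<Rightarrow> real \<Rightarrow> real" where
  "power_bound A r = (SUP n. onorm (A ^^ n) / r ^ n)"

end

theory Submission
  imports Defs
begin

text \<open>
  Fix \<open>r\<close> between the spectral radius of \<open>A\<close> and \<open>s\<close>, and write \<open>M\<close> for \<open>power_bound A r\<close>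
  and \<open>T\<close> for \<open>A + K\<close>. There is an equivalent norm \<open>\<nu>\<close>, with
  \<open>\<parallel>x\<parallel> \<le> \<nu> x \<le> M \<parallel>x\<parallel>\<close>, in which \<open>A\<close> has norm at most \<open>r\<close> (lemma \<open>adapted_norm\<close>). If
  \<open>2\<^bsup>k-1\<^esup>\<close> balls of radius \<open>\<epsilon>\<close> cover the image of the unit ball under \<open>K\<close>, then in the new norm
  \<open>2\<^bsup>k-1\<^esup>\<close> balls of radius \<open>\<rho> = r + M \<epsilon>\<close> cover the image of the unit ball under \<open>T\<close>, and
  \<open>2\<^bsup>(k-1)n\<^esup>\<close> balls of radius \<open>\<rho>\<^sup>n\<close> cover its image under \<open>T\<^sup>n\<close> (lemma
  \<open>cover_of_iterates\<close>).

  On the other hand, let \<open>N\<close> be the total algebraic multiplicity of finitely many eigenvalues of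
  modulus at least \<open>s\<close>. They provide an invariant subspace of dimension \<open>N\<close>, that is, of real dimension
  \<open>2 N\<close>, on which \<open>T\<close> is triangular (lemma \<open>triangular_chain_of_eigenvalues\<close>). There
  \<open>T\<^sup>n\<close> expands volume at least by \<open>s\<^bsup>2Nn\<^esup>\<close>, so about \<open>(s / \<rho>)\<^bsup>2Nn\<^esup>\<close> balls of radius
  \<open>\<rho>\<^sup>n\<close> are necessary. The volume comparison is carried out by counting lattice points
  (lemma \<open>packing_count\<close>). Comparing growth rates in \<open>n\<close> gives
  \<open>(s / \<rho>)\<^bsup>2N\<^esup> \<le> 2\<^bsup>k-1\<^esup>\<close> (lemma \<open>modulus_le_entropy\<close>). Inserting the decay
  \<open>k\<^bsup>-1/p\<^esup>\<close> of the entropy numbers and choosing \<open>k\<close> well yields the stated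
  constant (lemma \<open>optimise_entropy_bound\<close>).

  The adapted norm is finite because \<open>M\<close> is, which is the statement that
  powers of \<open>A\<close> grow no faster than \<open>r\<^sup>n\<close>. It is obtained from invertibility
  of \<open>1 - w A\<close> for \<open>\<bar>w\<bar> \<le> 1/r\<close> by averaging over roots of unity (lemma
  \<open>bounded_powers_step\<close>).
\<close>

section \<open>Bounded complex-linear operators and their resolvents\<close>

lemma bounded_clinearD:
  assumes "bounded_clinear T"
  shows "bounded_linear T" "T (x + y) = T x + T y" "T (x - y) = T x - T y"
    "T (c *\<^sub>C x) = c *\<^sub>C T x" "T 0 = 0" "T (a *\<^sub>R x) = a *\<^sub>R T x" "norm (T x) \<le> onorm T * norm x"
  using assms
  by (auto simp: bounded_clinear_def linear_simps onorm bounded_linear.linear)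

lemma bounded_linear_scaleC: "bounded_linear (\<lambda>x::'a::complex_banach. c *\<^sub>C x)"
proof (rule bounded_linear_intro[where K = "cmod c"])
  show "c *\<^sub>C (a *\<^sub>R x) = a *\<^sub>R (c *\<^sub>C x)" for a and x :: 'a
    by (simp flip: scaleC_of_real add: scaleC_scaleC mult.commute)
qed (auto simp: scaleC_add_right norm_scaleC mult.commute)

lemma bounded_clinear_comp:
  assumes "bounded_clinear S" "bounded_clinear T"
  shows "bounded_clinear (\<lambda>x. S (T x))"
  using assms by (auto simp: bounded_clinear_def intro: bounded_linear_compose)

lemma bounded_clinear_add:
  assumes "bounded_clinear S" "bounded_clinear T"
  shows "bounded_clinear (\<lambda>x. S x + T x)"
  using assms by (auto simp: bounded_clinear_def scaleC_add_right intro: bounded_linear_add)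

lemma bounded_clinear_scaleC:
  assumes "bounded_clinear T"
  shows "bounded_clinear (\<lambda>x. c *\<^sub>C T x)"
  using assms
  by (auto simp: bounded_clinear_def scaleC_scaleC mult.commute
      intro: bounded_linear_compose[OF bounded_linear_scaleC])

lemma bounded_clinear_id: "bounded_clinear (\<lambda>x. x)"
  by (simp add: bounded_clinear_def bounded_linear_ident)

lemma bounded_clinear_funpow:
  assumes "bounded_clinear T"
  shows "bounded_clinear (T ^^ n)"
proof (induction n)
  case 0
  then show ?case using bounded_clinear_id by (simp add: id_def)
next
  case (Suc n)
  then show ?case using bounded_clinear_comp[OF assms Suc] by (simp add: o_def)
qed

lemma cmod_greater_onorm_in_resolvent_set:
  fixes A :: "'a::complex_banach \<Rightarrow> 'a"
  assumes A: "bounded_clinear A" and z: "onorm A < cmod z"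
  shows "z \<in> resolvent_set A"
proof -
  have onn: "onorm A \<ge> 0" using A by (simp add: bounded_clinearD(1) onorm_pos_le)
  have z0: "z \<noteq> 0" using z onn by auto
  have ex: "\<exists>!y. z *\<^sub>C y - A y = x" for x
  proof -
    have eq: "z *\<^sub>C y - A y = x \<longleftrightarrow> (1/z) *\<^sub>C (x + A y) = y" for y
    proof
      assume "z *\<^sub>C y - A y = x"
      then have "x + A y = z *\<^sub>C y" by (simp add: algebra_simps)
      then show "(1/z) *\<^sub>C (x + A y) = y" using z0 by (simp add: scaleC_scaleC)
    next
      assume h: "(1/z) *\<^sub>C (x + A y) = y"
      have "z *\<^sub>C y = x + A y" using z0 by (subst h[symmetric]) (simp add: scaleC_scaleC)
      then show "z *\<^sub>C y - A y = x" by simp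
    qed
    \<comment> \<open>Solving for \<open>y\<close> is a fixed point problem for a contraction with constant \<open>\<parallel>A\<parallel> / \<bar>z\<bar>\<close>.\<close>
    have "\<exists>!y\<in>UNIV. (1/z) *\<^sub>C (x + A y) = y"
    proof (rule Banach_fix)
      show "onorm A / cmod z < 1" using z onn by (simp add: divide_less_eq)
      show "dist ((1 / z) *\<^sub>C (x + A a)) ((1 / z) *\<^sub>C (x + A b)) \<le> onorm A / cmod z * dist a b" for a b
      proof -
        have "(1 / z) *\<^sub>C (x + A a) - (1 / z) *\<^sub>C (x + A b) = (1/z) *\<^sub>C (A (a - b))"
          using A by (simp add: bounded_clinearD complex_vector.scale_right_diff_distrib
              complex_vector.scale_right_distrib)
        then show ?thesis
          using bounded_clinearD(7)[OF A, of "a - b"]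
          by (simp add: dist_norm norm_scaleC norm_divide divide_right_mono)
      qed
    qed (use onn in \<open>auto simp: complete_UNIV\<close>)
    then show ?thesis by (simp add: eq)
  qed
  define R where "R x = (THE y. z *\<^sub>C y - A y = x)" for x
  have R1: "z *\<^sub>C R x - A (R x) = x" for x
    unfolding R_def by (rule theI'[OF ex])
  have R2: "R x = y" if "z *\<^sub>C y - A y = x" for x y
    using ex[of x] R1[of x] that by blast
  have lower: "norm y \<le> norm (z *\<^sub>C y - A y) * (1 / (cmod z - onorm A))" for y
  proof -
    have "cmod z * norm y \<le> norm (z *\<^sub>C y - A y) + norm (A y)"
      by (metis norm_scaleC norm_triangle_sub add.commute)
    with bounded_clinearD(7)[OF A, of y] have "(cmod z - onorm A) * norm y \<le> norm (z *\<^sub>C y - A y)"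
      by (simp add: algebra_simps)
    then show ?thesis using z by (simp add: field_simps)
  qed
  have Rc: "R (c *\<^sub>C x) = c *\<^sub>C R x" for c x
  proof (rule R2)
    have "z *\<^sub>C c *\<^sub>C R x - A (c *\<^sub>C R x) = c *\<^sub>C (z *\<^sub>C R x - A (R x))"
      using A by (simp add: bounded_clinearD scaleC_scaleC mult.commute
          complex_vector.scale_right_diff_distrib)
    then show "z *\<^sub>C c *\<^sub>C R x - A (c *\<^sub>C R x) = c *\<^sub>C x" by (simp add: R1)
  qed
  have "bounded_linear R"
  proof (rule bounded_linear_intro)
    show "R (x + y) = R x + R y" for x y
    proof (rule R2)
      have "z *\<^sub>C (R x + R y) - A (R x + R y) = (z *\<^sub>C R x - A (R x)) + (z *\<^sub>C R y - A (R y))"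
        using A by (simp add: bounded_clinearD scaleC_add_right)
      then show "z *\<^sub>C (R x + R y) - A (R x + R y) = x + y" by (simp add: R1)
    qed
    show "R (a *\<^sub>R x) = a *\<^sub>R R x" for a x
      using Rc[of "of_real a" x] by (simp add: scaleC_of_real)
    show "norm (R x) \<le> norm x * (1 / (cmod z - onorm A))" for x
      using lower[of "R x"] by (simp add: R1)
  qed
  then have "bounded_clinear R" using Rc by (simp add: bounded_clinear_def)
  then show ?thesis
    unfolding resolvent_set_def using R1 R2 by blast
qed

text \<open>
  Without this bound the supremum in the definition of the spectral radius would be an
  unspecified number.
\<close>

lemma bdd_above_spectrum:
  assumes A: "bounded_clinear A"
  shows "bdd_above (insert 0 (cmod ` spectrum A))"
  unfolding bdd_above_insert
  using cmod_greater_onorm_in_resolvent_set[OF A]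
  by (intro bdd_aboveI[of _ "onorm A"]) (force simp: spectrum_def not_less[symmetric])

lemma cmod_greater_spectral_radius_in_resolvent_set:
  assumes A: "bounded_clinear A" and z: "spectral_radius A < cmod z"
  shows "z \<in> resolvent_set A"
proof (rule ccontr)
  assume "z \<notin> resolvent_set A"
  then have "cmod z \<in> insert 0 (cmod ` spectrum A)" by (simp add: spectrum_def)
  then have "cmod z \<le> spectral_radius A"
    unfolding spectral_radius_def by (rule cSup_upper[OF _ bdd_above_spectrum[OF A]])
  with z show False by simp
qed

lemma spectral_radius_nonneg:
  assumes A: "bounded_clinear A"
  shows "spectral_radius A \<ge> 0"
  unfolding spectral_radius_def by (rule cSup_upper[OF _ bdd_above_spectrum[OF A]]) simp

section \<open>Growth of powers and the spectral radius\<close>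

lemma sum_powers_of_root_of_unity:
  fixes n k :: nat
  assumes "k < n"
  defines "u \<equiv> \<lambda>j::nat. exp (2 * of_real pi * \<i> * of_nat j / of_nat n)"
  shows "(\<Sum>j<n. u j ^ k) = (if k = 0 then of_nat n else 0)"
proof (cases "k = 0")
  case False
  have u: "u j ^ k = u k ^ j" for j
    by (simp add: u_def exp_of_nat_mult[symmetric] mult.commute mult.left_commute)
  have "u k ^ n = 1" unfolding u_def using assms(1) by (intro complex_root_unity) auto
  moreover have "u k \<noteq> 1"
    using assms(1) False nat_dvd_not_less[of k n] complex_root_unity_eq_1[of n k] by (auto simp: u_def)
  ultimately have "(\<Sum>j<n. u k ^ j) = 0" by (simp add: geometric_sum)
  then show ?thesis using False by (simp add: u)
qed auto

text \<open>
  In the variable \<open>w = 1/z\<close> the resolvent extends over \<open>z = \<infinity>\<close>, so that the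
  whole closed disc \<open>\<bar>w\<bar> \<le> 1/r\<close> is available, and the disc is compact.
\<close>

lemma inverse_outside_spectral_radius:
  fixes A :: "'a::complex_banach \<Rightarrow> 'a"
  assumes A: "bounded_clinear A" and r: "r > spectral_radius A" and w: "cmod w * r \<le> 1"
  shows "\<exists>f. bounded_clinear f \<and> (\<forall>x. f x - w *\<^sub>C A (f x) = x) \<and> (\<forall>x. f (x - w *\<^sub>C A x) = x)"
proof (cases "w = 0")
  case True
  then show ?thesis using bounded_clinear_id by (intro exI[of _ "\<lambda>x. x"]) simp
next
  case False
  have "r \<le> cmod (1/w)"
    using w False by (simp add: norm_divide field_simps)
  then have "spectral_radius A < cmod (1/w)" using r by simp
  then have "1/w \<in> resolvent_set A" by (rule cmod_greater_spectral_radius_in_resolvent_set[OF A])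
  then obtain R where R: "bounded_clinear R" "\<And>x. (1/w) *\<^sub>C R x - A (R x) = x"
    "\<And>x. R ((1/w) *\<^sub>C x - A x) = x"
    by (auto simp: resolvent_set_def)
  define f where "f x = (1/w) *\<^sub>C R x" for x
  have "bounded_clinear f" unfolding f_def by (rule bounded_clinear_scaleC[OF R(1)])
  moreover have "f x - w *\<^sub>C A (f x) = x" for x
  proof -
    have "f x - w *\<^sub>C A (f x) = (1/w) *\<^sub>C R x - A (R x)"
      using False A by (simp add: f_def bounded_clinearD scaleC_scaleC)
    then show ?thesis by (simp add: R)
  qed
  moreover have "f (x - w *\<^sub>C A x) = x" for x
  proof -
    have "f (x - w *\<^sub>C A x) = R ((1/w) *\<^sub>C (x - w *\<^sub>C A x))"
      using R(1) by (simp add: f_def bounded_clinearD)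
    also have "(1/w) *\<^sub>C (x - w *\<^sub>C A x) = (1/w) *\<^sub>C x - A x"
      using False by (simp add: complex_vector.scale_right_diff_distrib scaleC_scaleC)
    finally show ?thesis by (simp add: R)
  qed
  ultimately show ?thesis by blast
qed

text \<open>
  A lower bound for \<open>1 - v A\<close> at one point \<open>v\<close> persists, with twice the constant,
  on a ball around \<open>v\<close>, and finitely many such balls cover the compact disc.
\<close>

lemma inverse_bounded_uniformly:
  fixes A :: "'a::complex_banach \<Rightarrow> 'a"
  assumes A: "bounded_clinear A" and r: "r > spectral_radius A"
  shows "\<exists>C>0. \<forall>w y. cmod w * r \<le> 1 \<longrightarrow> norm y \<le> C * norm (y - w *\<^sub>C A y)"
proof -
  have r0: "r > 0" using r spectral_radius_nonneg[OF A] by simp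
  define S where "S = cball (0::complex) (1/r)"
  have S: "w \<in> S \<longleftrightarrow> cmod w * r \<le> 1" for w using r0 by (simp add: S_def field_simps)
  have "\<exists>C>0. \<forall>y. norm y \<le> C * norm (y - w *\<^sub>C A y)" if "w \<in> S" for w
  proof -
    have "cmod w * r \<le> 1" using that S by simp
    from inverse_outside_spectral_radius[OF A r this]
    obtain f where f: "bounded_clinear f" "\<And>x. f (x - w *\<^sub>C A x) = x" by metis
    show ?thesis
    proof (intro exI[of _ "onorm f + 1"] conjI allI)
      show "onorm f + 1 > 0" using f(1) by (simp add: bounded_clinearD onorm_pos_le add_nonneg_pos)
      show "norm y \<le> (onorm f + 1) * norm (y - w *\<^sub>C A y)" for y
        using bounded_clinearD(7)[OF f(1), of "y - w *\<^sub>C A y"]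
        by (simp add: f(2) distrib_right add_increasing2)
    qed
  qed
  then obtain c where c: "\<And>w. w \<in> S \<Longrightarrow> c w > 0"
    "\<And>w y. w \<in> S \<Longrightarrow> norm y \<le> c w * norm (y - w *\<^sub>C A y)"
    by metis
  define a where "a = onorm A + 1"
  have a: "a > 0" "norm (A y) \<le> a * norm y" for y
    using bounded_clinearD(7)[OF A, of y] A
    by (simp_all add: a_def distrib_right bounded_clinearD onorm_pos_le add_nonneg_pos add_increasing2)
  have "compact S" by (simp add: S_def)
  moreover have "\<And>w. w \<in> S \<Longrightarrow> open (ball w (1 / (2 * a * c w)))" by simp
  moreover have "S \<subseteq> (\<Union>w\<in>S. ball w (1 / (2 * a * c w)))"
  proof
    fix w assume "w \<in> S"
    moreover from this have "w \<in> ball w (1 / (2 * a * c w))" using a c(1) by simp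
    ultimately show "w \<in> (\<Union>w\<in>S. ball w (1 / (2 * a * c w)))" by blast
  qed
  ultimately obtain F where F: "F \<subseteq> S" "finite F" "S \<subseteq> (\<Union>w\<in>F. ball w (1 / (2 * a * c w)))"
    by (rule compactE_image)
  have cF: "0 \<le> 2 * c w" if "w \<in> F" for w using c(1)[of w] that F(1) by auto
  show ?thesis
  proof (intro exI[of _ "1 + (\<Sum>w\<in>F. 2 * c w)"] conjI allI impI)
    have nn: "0 \<le> (\<Sum>w\<in>F. 2 * c w)" by (intro sum_nonneg cF)
    then show "0 < 1 + (\<Sum>w\<in>F. 2 * c w)" by simp
    fix w y assume "cmod w * r \<le> 1"
    then have "w \<in> (\<Union>w\<in>F. ball w (1 / (2 * a * c w)))" using F(3) S by blast
    then obtain v where v: "v \<in> F" "dist v w < 1 / (2 * a * c v)" by auto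
    then have vS: "v \<in> S" using F by auto
    have eq: "y - v *\<^sub>C A y = (y - w *\<^sub>C A y) + (w - v) *\<^sub>C A y"
      by (simp add: complex_vector.scale_left_diff_distrib)
    have "norm y \<le> c v * norm (y - v *\<^sub>C A y)" using c vS by blast
    also have "\<dots> \<le> c v * (norm (y - w *\<^sub>C A y) + cmod (w - v) * norm (A y))"
      unfolding eq using c(1)[OF vS] by (intro mult_left_mono norm_triangle_le) (simp_all add: norm_scaleC)
    also have "\<dots> \<le> c v * (norm (y - w *\<^sub>C A y) + 1 / (2 * a * c v) * (a * norm y))"
      using c(1)[OF vS] a v
      by (intro mult_left_mono add_left_mono mult_mono) (auto simp: dist_norm norm_minus_commute)
    also have "\<dots> = c v * norm (y - w *\<^sub>C A y) + norm y / 2"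
      using c(1)[OF vS] a by (simp add: field_simps)
    finally have "norm y \<le> 2 * c v * norm (y - w *\<^sub>C A y)" by simp
    also have "\<dots> \<le> (1 + (\<Sum>w\<in>F. 2 * c w)) * norm (y - w *\<^sub>C A y)"
    proof (rule mult_right_mono)
      have "2 * c v \<le> (\<Sum>w\<in>F. 2 * c w)"
        using F(2) v(1) by (intro member_le_sum cF) auto
      then show "2 * c v \<le> 1 + (\<Sum>w\<in>F. 2 * c w)" by simp
    qed simp
    finally show "norm y \<le> (1 + (\<Sum>w\<in>F. 2 * c w)) * norm (y - w *\<^sub>C A y)" .
  qed
qed

lemma telescoping_powers:
  assumes A: "bounded_clinear A"
  shows "y - w ^ n *\<^sub>C (A ^^ n) y
    = (\<Sum>k<n. w ^ k *\<^sub>C (A ^^ k) y) - w *\<^sub>C A (\<Sum>k<n. w ^ k *\<^sub>C (A ^^ k) y)"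
proof (induction n)
  case (Suc n)
  let ?S = "(\<Sum>k<n. w ^ k *\<^sub>C (A ^^ k) y)"
  have "(\<Sum>k<Suc n. w ^ k *\<^sub>C (A ^^ k) y) - w *\<^sub>C A (\<Sum>k<Suc n. w ^ k *\<^sub>C (A ^^ k) y)
    = (?S - w *\<^sub>C A ?S) + w ^ n *\<^sub>C (A ^^ n) y - w ^ Suc n *\<^sub>C (A ^^ Suc n) y"
    using A by (simp add: bounded_clinearD scaleC_add_right scaleC_scaleC algebra_simps)
  also have "\<dots> = y - w ^ Suc n *\<^sub>C (A ^^ Suc n) y" by (simp flip: Suc)
  finally show ?case by simp
qed (use A in \<open>simp add: bounded_clinearD\<close>)

text \<open>
  By the geometric sum \<open>telescoping_powers\<close>, \<open>(1 - u t A)\<^bsup>-1\<^esup> (1 - t\<^sup>n A\<^sup>n)\<close> is the sum of the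
  \<open>(u t A)\<^sup>k\<close> with \<open>k < n\<close> for every \<open>n\<close>-th root of unity \<open>u\<close>. Averaging
  over the roots of unity leaves the term \<open>k = 0\<close> only. So the average of the inverses, whose
  bounds do not depend on \<open>n\<close>, is a left inverse of \<open>1 - t\<^sup>n A\<^sup>n\<close>.
\<close>

lemma averaged_inverse:
  fixes A :: "'a::complex_banach \<Rightarrow> 'a" and f :: "complex \<Rightarrow> 'a \<Rightarrow> 'a" and n :: nat and t :: real
  assumes A: "bounded_clinear A" and n: "n > 0"
  defines "u \<equiv> \<lambda>j::nat. exp (2 * of_real pi * \<i> * of_nat j / of_nat n)"
  assumes f: "\<And>j x. f (u j * of_real t) (x - (u j * of_real t) *\<^sub>C A x) = x"
  shows "(1 / real n) *\<^sub>R (\<Sum>j<n. f (u j * of_real t) (y - t ^ n *\<^sub>R (A ^^ n) y)) = y"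
proof -
  have un: "u j ^ n = 1" for j unfolding u_def using n by (intro complex_root_unity) auto
  have "f (u j * of_real t) (y - t ^ n *\<^sub>R (A ^^ n) y) = (\<Sum>k<n. (u j * of_real t) ^ k *\<^sub>C (A ^^ k) y)" for j
  proof -
    have "t ^ n *\<^sub>R (A ^^ n) y = (u j * of_real t) ^ n *\<^sub>C (A ^^ n) y"
      by (simp add: power_mult_distrib un flip: scaleC_of_real)
    then show ?thesis using telescoping_powers[OF A, of y "u j * of_real t" n] by (simp add: f)
  qed
  then have "(\<Sum>j<n. f (u j * of_real t) (y - t ^ n *\<^sub>R (A ^^ n) y))
      = (\<Sum>k<n. \<Sum>j<n. (u j * of_real t) ^ k *\<^sub>C (A ^^ k) y)"
    by (subst sum.swap) simp
  also have "\<dots> = (\<Sum>k<n. ((\<Sum>j<n. u j ^ k) * of_real t ^ k) *\<^sub>C (A ^^ k) y)"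
    by (simp add: power_mult_distrib sum_distrib_right complex_vector.scale_sum_left)
  also have "\<dots> = (\<Sum>k<n. if k = 0 then real n *\<^sub>R y else 0)"
    using sum_powers_of_root_of_unity[of _ n]
    by (intro sum.cong refl) (auto simp: u_def simp flip: scaleC_of_real)
  also have "\<dots> = real n *\<^sub>R y" using n by (simp add: sum.delta)
  finally show ?thesis using n by simp
qed

text \<open>
  Let \<open>F\<^sub>n(t)\<close> be the averaged inverse, a left inverse of \<open>1 - t\<^sup>n A\<^sup>n\<close>. It is bounded
  and Lipschitz in \<open>t\<close> with constants that depend neither on \<open>n\<close> nor on \<open>t\<close>. If
  \<open>t\<^sup>n A\<^sup>n\<close> stays bounded, then at a slightly smaller parameter \<open>\<tau>\<close> (or at \<open>\<tau> = 0\<close>) the powers \<open>\<tau>\<^sup>n A\<^sup>n\<close> tend to \<open>0\<close>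
  and \<open>F\<^sub>n(\<tau>)\<close> tends to the identity. By the Lipschitz bound \<open>F\<^sub>n(t')\<close> is
  then within \<open>1/2\<close> of the identity for large \<open>n\<close>, even for \<open>t'\<close> slightly larger than
  \<open>t\<close>, and this forces \<open>\<parallel>t'\<^sup>n A\<^sup>n\<parallel> \<le> 1\<close> for such \<open>n\<close>. The step size is the same for all
  \<open>t\<close>, which is what makes the induction over steps reach \<open>1/r\<close>.
\<close>

lemma bounded_powers_step:
  fixes A :: "'a::complex_banach \<Rightarrow> 'a"
  assumes A: "bounded_clinear A" and r: "r > spectral_radius A"
  shows "\<exists>\<delta>>0. \<forall>t t'. 0 \<le> t \<longrightarrow> t \<le> t' \<longrightarrow> t' \<le> t + \<delta> \<longrightarrow> t' * r \<le> 1
     \<longrightarrow> (\<exists>B. \<forall>n x. norm (t ^ n *\<^sub>R (A ^^ n) x) \<le> B * norm x)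
     \<longrightarrow> (\<exists>B. \<forall>n x. norm (t' ^ n *\<^sub>R (A ^^ n) x) \<le> B * norm x)"
proof -
  have r0: "r > 0" using r spectral_radius_nonneg[OF A] by simp
  obtain C where C: "C > 0" "\<And>w y. cmod w * r \<le> 1 \<Longrightarrow> norm y \<le> C * norm (y - w *\<^sub>C A y)"
    using inverse_bounded_uniformly[OF A r] by blast
  obtain f where f: "\<And>w. cmod w * r \<le> 1 \<Longrightarrow> bounded_clinear (f w)"
     "\<And>w x. cmod w * r \<le> 1 \<Longrightarrow> f w x - w *\<^sub>C A (f w x) = x"
     "\<And>w x. cmod w * r \<le> 1 \<Longrightarrow> f w (x - w *\<^sub>C A x) = x"
    using inverse_outside_spectral_radius[OF A r] by metis
  define a where "a = onorm A + 1"
  have a: "a > 0" "norm (A y) \<le> a * norm y" for y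
    using bounded_clinearD(7)[OF A, of y] A
    by (simp_all add: a_def distrib_right bounded_clinearD onorm_pos_le add_nonneg_pos add_increasing2)
  have fC: "norm (f w x) \<le> C * norm x" if "cmod w * r \<le> 1" for w x
    using C(2)[OF that, of "f w x"] f(2)[OF that, of x] by simp
  define L where "L = C * a * C"
  have L: "L > 0" using C a by (simp add: L_def)
  have lip: "norm (f w x - f w' x) \<le> L * cmod (w - w') * norm x"
    if w: "cmod w * r \<le> 1" and w': "cmod w' * r \<le> 1" for w w' x
  proof -
    let ?d = "f w x - f w' x"
    have "?d - w *\<^sub>C A ?d = (f w x - w *\<^sub>C A (f w x)) - (f w' x - w' *\<^sub>C A (f w' x)) + (w - w') *\<^sub>C A (f w' x)"
      using A by (simp add: bounded_clinearD algebra_simps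
          complex_vector.scale_right_diff_distrib complex_vector.scale_left_diff_distrib)
    also have "\<dots> = (w - w') *\<^sub>C A (f w' x)" by (simp add: f(2) w w')
    finally have "norm ?d \<le> C * (cmod (w - w') * norm (A (f w' x)))"
      using C(2)[OF w, of ?d] by (simp add: norm_scaleC)
    also have "\<dots> \<le> C * (cmod (w - w') * (a * (C * norm x)))"
      using C(1) a(1) fC[OF w', of x]
      by (intro mult_left_mono order_trans[OF a(2)]) auto
    finally show ?thesis by (simp add: L_def mult_ac)
  qed
  \<comment> \<open>Below, \<open>\<bar>\<tau> - t'\<bar> \<le> 2 \<delta>\<close>, so that \<open>F\<^sub>n\<close> changes by at most
  \<open>2 \<delta> L = 1/6\<close>; together with \<open>1/6\<close> from the decay of \<open>\<tau>\<^sup>n A\<^sup>n\<close> this gives \<open>1/3\<close>.\<close>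
  define \<delta> where "\<delta> = 1 / (12 * L)"
  have \<delta>: "\<delta> > 0" using L by (simp add: \<delta>_def)
  define u where "u n j = exp (2 * of_real pi * \<i> * of_nat j / of_nat n)" for n j :: nat
  have normu: "cmod (u n j) = 1" for n j by (simp add: u_def)
  define F where "F n t x = (1 / real n) *\<^sub>R (\<Sum>j<n. f (u n j * of_real t) x)" for n :: nat and t :: real and x :: 'a
  have in_disc: "cmod (u n j * of_real t) * r \<le> 1" if "0 \<le> t" "t * r \<le> 1" for n j t
    using that by (simp add: norm_mult normu)
  have F_inv: "F n t (y - t ^ n *\<^sub>R (A ^^ n) y) = y" if "n > 0" "0 \<le> t" "t * r \<le> 1" for n t y
    unfolding F_def u_def
    using that in_disc[OF that(2,3)] by (intro averaged_inverse[OF A] f(3)) (auto simp: u_def)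
  have F_diff: "F n t (x - y) = F n t x - F n t y" if "0 \<le> t" "t * r \<le> 1" for n t x y
    using f(1)[OF in_disc[OF that]]
    by (simp add: F_def bounded_clinearD sum_subtractf scaleR_diff_right)
  have F_bound: "norm (F n t x) \<le> C * norm x" if "n > 0" "0 \<le> t" "t * r \<le> 1" for n t x
  proof -
    have "norm (\<Sum>j<n. f (u n j * of_real t) x) \<le> real (card {..<n}) * (C * norm x)"
      using in_disc that by (intro sum_norm_bound fC) auto
    then show ?thesis using that(1) by (simp add: F_def field_simps)
  qed
  have F_lip: "norm (F n t x - F n t' x) \<le> L * \<bar>t - t'\<bar> * norm x"
    if "n > 0" "0 \<le> t" "t * r \<le> 1" "0 \<le> t'" "t' * r \<le> 1" for n t t' x
  proof -
    have le: "norm (\<Sum>j<n. f (u n j * of_real t) x - f (u n j * of_real t') x)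
      \<le> real (card {..<n}) * (L * \<bar>t - t'\<bar> * norm x)"
    proof (rule sum_norm_bound)
      fix j
      have "cmod (u n j * of_real t - u n j * of_real t') = \<bar>t - t'\<bar>"
        by (simp add: normu norm_mult flip: right_diff_distrib of_real_diff)
      then show "norm (f (u n j * of_real t) x - f (u n j * of_real t') x) \<le> L * \<bar>t - t'\<bar> * norm x"
        using lip[OF in_disc[where n = n and j = j, OF that(2,3)] in_disc[where n = n and j = j, OF that(4,5)]]
        by simp
    qed
    have "norm (F n t x - F n t' x) = norm (\<Sum>j<n. f (u n j * of_real t) x - f (u n j * of_real t') x) / real n"
      by (simp add: F_def sum_subtractf flip: scaleR_diff_right)
    also have "\<dots> \<le> (real n * (L * \<bar>t - t'\<bar> * norm x)) / real n"
      using le by (intro divide_right_mono) auto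
    finally show ?thesis using that(1) by simp
  qed
  show ?thesis
  proof (rule exI[of _ \<delta>], intro conjI allI impI)
    fix t t' assume t: "0 \<le> t" "t \<le> t'" "t' \<le> t + \<delta>" "t' * r \<le> 1"
      and "\<exists>B. \<forall>n x. norm (t ^ n *\<^sub>R (A ^^ n) x) \<le> B * norm x"
    then obtain B0 where B0: "norm (t ^ n *\<^sub>R (A ^^ n) x) \<le> B0 * norm x" for n x by blast
    define B where "B = \<bar>B0\<bar>"
    have B: "norm (t ^ n *\<^sub>R (A ^^ n) x) \<le> B * norm x" for n x
      using B0[of n x] by (simp add: B_def order_trans[OF _ mult_right_mono])
    have Bnn: "B \<ge> 0" by (simp add: B_def)
    define \<tau> where "\<tau> = max 0 (t - \<delta>)"
    have tr: "t * r \<le> 1" using t(2,4) r0 by (meson mult_right_mono less_imp_le order_trans)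
    have \<tau>: "0 \<le> \<tau>" "\<tau> \<le> t" "\<bar>\<tau> - t'\<bar> \<le> 2 * \<delta>" "0 < t \<Longrightarrow> \<tau> < t" using t \<delta> by (auto simp: \<tau>_def)
    have \<tau>r: "\<tau> * r \<le> 1" using \<tau>(2) r0 tr by (meson mult_right_mono less_imp_le order_trans)
    have t0': "0 \<le> t'" using t by simp
    define q where "q = \<tau> / t"
    have q: "0 \<le> q" "q < 1" "\<tau> = q * t" using \<tau> t(1) by (cases "t = 0"; simp add: q_def)+
    have "(\<lambda>n. C * (q ^ n * B)) \<longlonglongrightarrow> C * (0 * B)"
      using q by (intro tendsto_intros LIMSEQ_realpow_zero) auto
    then have "eventually (\<lambda>n. C * (q ^ n * B) < 1/6) sequentially"
      by (rule order_tendstoD) simp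
    then obtain n0 where n0: "\<And>n. n \<ge> n0 \<Longrightarrow> C * (q ^ n * B) < 1/6"
      by (auto simp: eventually_sequentially)
    have large: "norm (t' ^ n *\<^sub>R (A ^^ n) y) \<le> norm y" if n: "n \<ge> n0" "n > 0" for n y
    proof -
      have near: "norm (F n \<tau> x - x) \<le> norm x / 6" for x
      proof -
        let ?x = "\<tau> ^ n *\<^sub>R (A ^^ n) x"
        have "F n \<tau> x - x = F n \<tau> ?x"
          using F_inv[OF n(2) \<tau>(1) \<tau>r, of x] F_diff[OF \<tau>(1) \<tau>r, of n x ?x]
          by (simp add: algebra_simps)
        then have "norm (F n \<tau> x - x) \<le> C * norm ?x" using F_bound[OF n(2) \<tau>(1) \<tau>r, of ?x] by simp
        also have "norm ?x = q ^ n * norm (t ^ n *\<^sub>R (A ^^ n) x)"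
          using q(1) by (simp add: q(3) power_mult_distrib abs_mult power_abs)
        also have "C * \<dots> \<le> C * (q ^ n * (B * norm x))"
          using C(1) q(1) B by (intro mult_left_mono) auto
        also have "\<dots> = (C * (q ^ n * B)) * norm x" by simp
        also have "\<dots> \<le> 1/6 * norm x" using n0[OF n(1)] by (intro mult_right_mono) auto
        finally show ?thesis by simp
      qed
      define x where "x = y - t' ^ n *\<^sub>R (A ^^ n) y"
      have Fx: "F n t' x = y" using F_inv[OF n(2) t0' t(4)] by (simp add: x_def)
      have "L * \<bar>\<tau> - t'\<bar> \<le> L * (2 * \<delta>)" using L \<tau>(3) by (intro mult_left_mono) auto
      also have "\<dots> = 1/6" using L by (simp add: \<delta>_def)
      finally have "norm (F n \<tau> x - F n t' x) \<le> 1/6 * norm x"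
        by (intro order_trans[OF F_lip[OF n(2) \<tau>(1) \<tau>r t0' t(4)]] mult_right_mono) auto
      then have "norm (y - x) \<le> norm x / 3"
        using near[of x] norm_triangle_ineq4[of "F n \<tau> x - x" "F n \<tau> x - y"] by (simp add: Fx)
      moreover have "norm x \<le> norm y + norm (y - x)"
        by (metis norm_triangle_sub norm_minus_commute)
      ultimately have "norm (y - x) \<le> norm y" using norm_ge_zero[of y] norm_ge_zero[of "y - x"] by linarith
      then show ?thesis by (simp add: x_def)
    qed
    define B' where "B' = 1 + (\<Sum>n<Suc n0. \<bar>t'\<bar> ^ n * onorm (A ^^ n))"
    have on: "0 \<le> \<bar>t'\<bar> ^ n * onorm (A ^^ n)" for n
      using bounded_clinear_funpow[OF A, of n] by (simp add: bounded_clinearD onorm_pos_le)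
    have B'1: "1 \<le> B'" unfolding B'_def using on by (simp add: sum_nonneg del: sum.lessThan_Suc)
    show "\<exists>B. \<forall>n x. norm (t' ^ n *\<^sub>R (A ^^ n) x) \<le> B * norm x"
    proof (intro exI[of _ B'] allI)
      fix n x
      show "norm (t' ^ n *\<^sub>R (A ^^ n) x) \<le> B' * norm x"
      proof (cases "n < Suc n0")
        case True
        have "norm (t' ^ n *\<^sub>R (A ^^ n) x) \<le> (\<bar>t'\<bar> ^ n * onorm (A ^^ n)) * norm x"
          using bounded_clinearD(7)[OF bounded_clinear_funpow[OF A, of n], of x]
          by (simp add: power_abs mult.assoc mult_left_mono)
        also have "\<bar>t'\<bar> ^ n * onorm (A ^^ n) \<le> (\<Sum>n<Suc n0. \<bar>t'\<bar> ^ n * onorm (A ^^ n))"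
          using True on by (intro member_le_sum) auto
        also have "\<dots> \<le> B'" by (simp add: B'_def)
        finally show ?thesis by (simp add: mult_right_mono)
      next
        case False
        then have "norm (t' ^ n *\<^sub>R (A ^^ n) x) \<le> norm x" using large by simp
        then show ?thesis using B'1 by (simp add: mult_le_cancel_right1 order_trans)
      qed
    qed
  qed (rule \<delta>)
qed

text \<open>
  The upper half of the spectral radius formula, reached from \<open>t = 0\<close> in finitely many steps
  of fixed length.
\<close>

lemma bounded_powers_beyond_spectral_radius:
  fixes A :: "'a::complex_banach \<Rightarrow> 'a"
  assumes A: "bounded_clinear A" and r: "r > spectral_radius A"
  shows "\<exists>B. \<forall>n x. norm ((A ^^ n) x) / r ^ n \<le> B * norm x"
proof -
  have r0: "r > 0" using r spectral_radius_nonneg[OF A] by simp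
  obtain \<delta> where \<delta>: "\<delta> > 0" and step: "\<And>t t'. 0 \<le> t \<Longrightarrow> t \<le> t' \<Longrightarrow> t' \<le> t + \<delta> \<Longrightarrow> t' * r \<le> 1
     \<Longrightarrow> (\<exists>B. \<forall>n x. norm (t ^ n *\<^sub>R (A ^^ n) x) \<le> B * norm x)
     \<Longrightarrow> (\<exists>B. \<forall>n x. norm (t' ^ n *\<^sub>R (A ^^ n) x) \<le> B * norm x)"
    using bounded_powers_step[OF A r] by blast
  have all: "\<exists>B. \<forall>n x. norm (min (real k * \<delta>) (1/r) ^ n *\<^sub>R (A ^^ n) x) \<le> B * norm x" for k :: nat
  proof (induction k)
    case 0
    have "norm ((min (real 0 * \<delta>) (1/r)) ^ n *\<^sub>R (A ^^ n) x) \<le> 1 * norm x" for n x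
      using r0 by (cases n) auto
    then show ?case by blast
  next
    case (Suc k)
    show ?case
    proof (rule step[OF _ _ _ _ Suc])
      show "0 \<le> min (real k * \<delta>) (1/r)" using \<delta> r0 by simp
      show "min (real k * \<delta>) (1 / r) \<le> min (real (Suc k) * \<delta>) (1 / r)"
        using \<delta> by (intro min.mono) (auto simp: distrib_right)
      show "min (real (Suc k) * \<delta>) (1 / r) \<le> min (real k * \<delta>) (1 / r) + \<delta>"
        using \<delta> by (simp add: distrib_right min_def)
      have "min (real (Suc k) * \<delta>) (1 / r) * r \<le> (1/r) * r" using r0 by (intro mult_right_mono) auto
      then show "min (real (Suc k) * \<delta>) (1 / r) * r \<le> 1" using r0 by simp
    qed
  qed
  obtain k where "1/r < real k * \<delta>" using reals_Archimedean3[OF \<delta>] by blast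
  then have "min (real k * \<delta>) (1/r) = 1/r" by simp
  with all[of k] have "\<exists>B. \<forall>n x. norm ((1/r) ^ n *\<^sub>R (A ^^ n) x) \<le> B * norm x" by simp
  then show ?thesis using r0 by (simp add: power_inverse divide_inverse mult.commute)
qed

lemma power_bound_bdd:
  fixes A :: "'a::complex_banach \<Rightarrow> 'a"
  assumes A: "bounded_clinear A" and r: "r > spectral_radius A"
  shows "bdd_above (range (\<lambda>n. onorm (A ^^ n) / r ^ n))"
proof -
  have r0: "r > 0" using r spectral_radius_nonneg[OF A] by simp
  obtain B where B: "norm ((A ^^ n) x) / r ^ n \<le> B * norm x" for n x
    using bounded_powers_beyond_spectral_radius[OF A r] by blast
  have "norm ((A ^^ n) x) \<le> (\<bar>B\<bar> * r ^ n) * norm x" for n x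
  proof -
    have "norm ((A ^^ n) x) / r ^ n \<le> \<bar>B\<bar> * norm x"
      by (rule order_trans[OF B]) (simp add: mult_right_mono)
    then show ?thesis using r0 by (simp add: field_simps)
  qed
  then have "onorm (A ^^ n) \<le> \<bar>B\<bar> * r ^ n" for n
    using r0 by (intro onorm_bound) auto
  then have "onorm (A ^^ n) / r ^ n \<le> \<bar>B\<bar>" for n
    using r0 by (simp add: field_simps)
  then show ?thesis by (intro bdd_aboveI[of _ "\<bar>B\<bar>"]) auto
qed

lemma norm_funpow_le_power_bound:
  fixes A :: "'a::complex_banach \<Rightarrow> 'a"
  assumes A: "bounded_clinear A" and r: "r > spectral_radius A"
  shows "norm ((A ^^ n) x) / r ^ n \<le> power_bound A r * norm x"
proof -
  have r0: "r > 0" using r spectral_radius_nonneg[OF A] by simp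
  have "norm ((A ^^ n) x) / r ^ n \<le> onorm (A ^^ n) / r ^ n * norm x"
    using bounded_clinearD(7)[OF bounded_clinear_funpow[OF A, of n], of x] r0
    by (simp add: divide_right_mono)
  also have "onorm (A ^^ n) / r ^ n \<le> power_bound A r"
    unfolding power_bound_def by (intro cSUP_upper power_bound_bdd[OF A r]) auto
  finally show ?thesis by (simp add: mult_right_mono)
qed

lemma power_bound_nonneg:
  fixes A :: "'a::complex_banach \<Rightarrow> 'a"
  assumes A: "bounded_clinear A" and r: "r > spectral_radius A"
  shows "power_bound A r \<ge> 0"
proof -
  have "0 \<le> onorm (A ^^ 0) / r ^ 0"
    using bounded_clinear_funpow[OF A, of 0] by (simp add: bounded_clinearD onorm_pos_le del: funpow.simps)
  also have "\<dots> \<le> power_bound A r"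
    unfolding power_bound_def by (intro cSUP_upper power_bound_bdd[OF A r]) auto
  finally show ?thesis .
qed

section \<open>Adapted norms and coverings\<close>

text \<open>
  Norms adapted to an operator are plain functions \<open>\<nu>\<close> here, because the type already carries
  its own norm.
\<close>

definition complex_seminorm :: "('a::complex_banach \<Rightarrow> real) \<Rightarrow> bool" where
  "complex_seminorm \<nu> \<longleftrightarrow>
     (\<forall>x y. \<nu> (x + y) \<le> \<nu> x + \<nu> y) \<and> (\<forall>c x. \<nu> (c *\<^sub>C x) = cmod c * \<nu> x)"

lemma complex_seminorm_minus:
  assumes "complex_seminorm \<nu>"
  shows "\<nu> (- x) = \<nu> x"
proof -
  have "\<nu> (- x) = \<nu> ((-1) *\<^sub>C x)" by simp
  also have "\<dots> = \<nu> x" using assms unfolding complex_seminorm_def by (metis norm_minus_cancel norm_one mult_1)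
  finally show ?thesis .
qed

lemma complex_seminorm_diff:
  assumes "complex_seminorm \<nu>"
  shows "\<nu> (x - y) \<le> \<nu> x + \<nu> y"
  using assms complex_seminorm_minus[OF assms, of y] unfolding complex_seminorm_def
  by (metis diff_conv_add_uminus)

lemma complex_seminorm_sum:
  assumes "complex_seminorm \<nu>"
  shows "\<nu> (\<Sum>i\<in>I. f i) \<le> (\<Sum>i\<in>I. \<nu> (f i))"
proof -
  have "\<nu> 0 = cmod 0 * \<nu> 0" using assms unfolding complex_seminorm_def
    by (metis complex_vector.scale_zero_left)
  then have "\<nu> 0 = 0" by simp
  moreover have "\<nu> (x + y) \<le> \<nu> x + \<nu> y" for x y
    using assms by (simp add: complex_seminorm_def)
  ultimately show ?thesis
    by (induction I rule: infinite_finite_induct) (auto intro: order_trans[OF _ add_left_mono])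
qed

text \<open>
  The supremum of \<open>\<parallel>A\<^sup>n x\<parallel> / r\<^sup>n\<close> over all \<open>n\<close> is an equivalent norm in which
  \<open>A\<close> has norm at most \<open>r\<close>: applying \<open>A\<close> merely shifts the sequence. The price is the
  factor \<open>power_bound A r\<close>, and this is where that quantity enters the final estimate.
\<close>

lemma adapted_norm:
  fixes A :: "'a::complex_banach \<Rightarrow> 'a"
  assumes A: "bounded_clinear A" and r: "r > spectral_radius A"
  obtains \<nu> where "complex_seminorm \<nu>" "\<And>x. norm x \<le> \<nu> x" "\<And>x. \<nu> x \<le> power_bound A r * norm x"
    "\<And>x. \<nu> (A x) \<le> r * \<nu> x"
proof -
  have r0: "r > 0" using r spectral_radius_nonneg[OF A] by simp
  define \<nu> where "\<nu> x = (SUP n. norm ((A ^^ n) x) / r ^ n)" for x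
  have bdd: "bdd_above (range (\<lambda>n. norm ((A ^^ n) x) / r ^ n))" for x
    using norm_funpow_le_power_bound[OF A r] by (intro bdd_aboveI) auto
  have upper: "norm ((A ^^ n) x) / r ^ n \<le> \<nu> x" for n x
    unfolding \<nu>_def by (intro cSUP_upper bdd) auto
  have least: "\<nu> x \<le> c" if "\<And>n. norm ((A ^^ n) x) / r ^ n \<le> c" for x c
    unfolding \<nu>_def using that by (intro cSUP_least) auto
  note lin = bounded_clinearD[OF bounded_clinear_funpow[OF A]]
  have scale_le: "\<nu> (c *\<^sub>C x) \<le> cmod c * \<nu> x" for c x
  proof (rule least)
    show "norm ((A ^^ n) (c *\<^sub>C x)) / r ^ n \<le> cmod c * \<nu> x" for n
      using mult_left_mono[OF upper[of n x], of "cmod c"] by (simp add: lin norm_scaleC)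
  qed
  have "\<nu> (c *\<^sub>C x) = cmod c * \<nu> x" for c x
  proof (cases "c = 0")
    case True
    have "\<nu> 0 \<le> 0" using scale_le[of 0 x] by simp
    moreover have "0 \<le> \<nu> 0" using upper[of 0 0] by simp
    ultimately show ?thesis using True by simp
  next
    case False
    have "cmod c * \<nu> x \<le> \<nu> (c *\<^sub>C x)"
      using scale_le[of "1/c" "c *\<^sub>C x"] False by (simp add: scaleC_scaleC norm_divide field_simps)
    with scale_le show ?thesis by (meson order_antisym)
  qed
  moreover have "\<nu> (x + y) \<le> \<nu> x + \<nu> y" for x y
  proof (rule least)
    fix n
    have "norm ((A ^^ n) (x + y)) / r ^ n \<le> norm ((A ^^ n) x) / r ^ n + norm ((A ^^ n) y) / r ^ n"
      using r0 by (simp add: lin norm_triangle_ineq divide_right_mono flip: add_divide_distrib)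
    also have "\<dots> \<le> \<nu> x + \<nu> y" by (intro add_mono upper)
    finally show "norm ((A ^^ n) (x + y)) / r ^ n \<le> \<nu> x + \<nu> y" .
  qed
  ultimately have "complex_seminorm \<nu>" unfolding complex_seminorm_def by blast
  moreover have "norm x \<le> \<nu> x" for x using upper[of 0 x] by simp
  moreover have "\<nu> x \<le> power_bound A r * norm x" for x
    by (intro least norm_funpow_le_power_bound A r)
  moreover have "\<nu> (A x) \<le> r * \<nu> x" for x
  proof (rule least)
    show "norm ((A ^^ n) (A x)) / r ^ n \<le> r * \<nu> x" for n
      using upper[of "Suc n" x] r0 by (simp add: funpow_swap1 field_simps)
  qed
  ultimately show ?thesis by (rule that)
qed

lemma entropy_number_radii_nonempty:
  fixes K :: "'a::complex_banach \<Rightarrow> 'a"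
  assumes K: "bounded_clinear K"
  shows "{\<epsilon>. \<epsilon> > 0 \<and>
     (\<exists>q y. q \<le> (2::nat) ^ (k - 1) \<and> K ` cball 0 1 \<subseteq> (\<Union>i\<in>{1..q}. cball (y i) \<epsilon>))} \<noteq> {}"
    (is "?E \<noteq> {}")
proof -
  have "onorm K + 1 \<in> ?E"
  proof (intro CollectI conjI exI[of _ "1::nat"] exI[of _ "\<lambda>i::nat. 0"])
    show "0 < onorm K + 1" using K by (simp add: bounded_clinearD onorm_pos_le add_nonneg_pos)
    show "K ` cball 0 1 \<subseteq> (\<Union>i\<in>{1..1::nat}. cball 0 (onorm K + 1))"
    proof clarsimp
      fix x :: 'a assume "norm x \<le> 1"
      then have "onorm K * norm x \<le> onorm K * 1"
        using K by (intro mult_left_mono) (simp_all add: bounded_clinearD onorm_pos_le)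
      with bounded_clinearD(7)[OF K, of x] show "norm (K x) \<le> onorm K + 1" by simp
    qed
  qed simp
  then show ?thesis by (metis empty_iff)
qed

lemma entropy_number_cover:
  fixes K :: "'a::complex_banach \<Rightarrow> 'a"
  assumes K: "bounded_clinear K" and e: "entropy_number k K < \<epsilon>"
  shows "\<exists>Y. finite Y \<and> card Y \<le> 2 ^ (k - 1) \<and> (\<forall>x. norm x \<le> 1 \<longrightarrow> (\<exists>y\<in>Y. norm (K x - y) \<le> \<epsilon>))"
proof -
  let ?E = "{\<epsilon>. \<epsilon> > 0 \<and>
     (\<exists>q y. q \<le> (2::nat) ^ (k - 1) \<and> K ` cball 0 1 \<subseteq> (\<Union>i\<in>{1..q}. cball (y i) \<epsilon>))}"
  have "?E \<noteq> {}" by (rule entropy_number_radii_nonempty[OF K])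
  then obtain e' where e': "e' \<in> ?E" "e' < \<epsilon>"
    using cInf_lessD[of ?E \<epsilon>] e unfolding entropy_number_def by blast
  then obtain q y where q: "q \<le> (2::nat) ^ (k - 1)" "K ` cball 0 1 \<subseteq> (\<Union>i\<in>{1..q}. cball (y i) e')" by blast
  show ?thesis
  proof (intro exI[of _ "y ` {1..q}"] conjI allI impI)
    show "card (y ` {1..q}) \<le> 2 ^ (k - 1)"
      using q(1) card_image_le[of "{1..q}" y] by simp
    fix x :: 'a assume "norm x \<le> 1"
    then have "K x \<in> K ` cball 0 1" by simp
    with q(2) have "K x \<in> (\<Union>i\<in>{1..q}. cball (y i) e')" by blast
    then obtain i where "i \<in> {1..q}" "dist (y i) (K x) \<le> e'" by auto
    then show "\<exists>z\<in>y ` {1..q}. norm (K x - z) \<le> \<epsilon>"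
      using e'(2) by (force simp: dist_norm norm_minus_commute)
  qed auto
qed

text \<open>
  If \<open>\<rho>\<close>-balls around \<open>Y\<close> cover the image of the unit ball, rescaling gives a cover of the image
  of every \<open>\<rho>\<^sup>n\<close>-ball by \<open>\<rho>\<^bsup>n+1\<^esup>\<close>-balls, as many as \<open>Y\<close> has points.
\<close>

lemma cover_of_iterates:
  fixes T :: "'a::complex_banach \<Rightarrow> 'a"
  assumes \<nu>: "complex_seminorm \<nu>" and T: "bounded_clinear T" and \<rho>: "\<rho> > 0"
    and Y: "finite Y" "\<And>x. \<nu> x \<le> 1 \<Longrightarrow> \<exists>y\<in>Y. \<nu> (T x - y) \<le> \<rho>"
  shows "\<exists>Z. finite Z \<and> card Z \<le> card Y ^ n \<and>
     (\<forall>x. \<nu> x \<le> 1 \<longrightarrow> (\<exists>z\<in>Z. \<nu> ((T ^^ n) x - z) \<le> \<rho> ^ n))"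
proof (induction n)
  case 0
  show ?case by (intro exI[of _ "{0}"]) simp
next
  case (Suc n)
  then obtain Z where Z: "finite Z" "card Z \<le> card Y ^ n"
    "\<And>x. \<nu> x \<le> 1 \<Longrightarrow> \<exists>z\<in>Z. \<nu> ((T ^^ n) x - z) \<le> \<rho> ^ n" by blast
  let ?g = "\<lambda>(z, y). T z + of_real (\<rho> ^ n) *\<^sub>C y"
  show ?case
  proof (intro exI[of _ "?g ` (Z \<times> Y)"] conjI allI impI)
    show "finite (?g ` (Z \<times> Y))" using Z(1) Y(1) by blast
    have "card (?g ` (Z \<times> Y)) \<le> card (Z \<times> Y)" using Z(1) Y(1) by (intro card_image_le) auto
    also have "\<dots> = card Y * card Z" by (simp add: card_cartesian_product)
    also have "\<dots> \<le> card Y ^ Suc n" using Z(2) by simp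
    finally show "card (?g ` (Z \<times> Y)) \<le> card Y ^ Suc n" .
    fix x assume "\<nu> x \<le> 1"
    then obtain z where z: "z \<in> Z" "\<nu> ((T ^^ n) x - z) \<le> \<rho> ^ n" using Z(3) by blast
    define c :: complex where "c = of_real (\<rho> ^ n)"
    have c: "c \<noteq> 0" "cmod c = \<rho> ^ n" using \<rho> by (auto simp: c_def norm_power)
    define w where "w = (1/c) *\<^sub>C ((T ^^ n) x - z)"
    have xw: "(T ^^ n) x = z + c *\<^sub>C w" using c by (simp add: w_def scaleC_scaleC)
    have "\<nu> w = \<nu> ((T ^^ n) x - z) / \<rho> ^ n"
      using \<nu> c by (simp add: w_def complex_seminorm_def norm_divide)
    then have "\<nu> w \<le> 1" using z(2) \<rho> by (simp add: divide_le_eq_1)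
    then obtain y where y: "y \<in> Y" "\<nu> (T w - y) \<le> \<rho>" using Y(2) by blast
    have "(T ^^ Suc n) x - ?g (z, y) = c *\<^sub>C (T w - y)"
      using T unfolding c_def[symmetric]
      by (simp add: xw bounded_clinearD complex_vector.scale_right_diff_distrib flip: c_def)
    then have "\<nu> ((T ^^ Suc n) x - ?g (z, y)) = \<rho> ^ n * \<nu> (T w - y)"
      using \<nu> c unfolding complex_seminorm_def by metis
    also have "\<dots> \<le> \<rho> ^ Suc n" using y(2) \<rho> by (simp add: mult.commute[of \<rho>])
    finally show "\<exists>v\<in>?g ` (Z \<times> Y). \<nu> ((T ^^ Suc n) x - v) \<le> \<rho> ^ Suc n"
      using z(1) y(1) by blast
  qed
qed

section \<open>Triangular chains and the packing estimate\<close>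

abbreviation cspan :: "'a::complex_banach set \<Rightarrow> 'a set" where "cspan \<equiv> complex_vector.span"

text \<open>
  A basis of an invariant subspace in which \<open>T\<close> is upper triangular with diagonal \<open>l\<close>. Linear
  independence is expressed stepwise, since the packing argument uses exactly the distance of
  each vector to the span of its predecessors.
\<close>

definition triangular_chain ::
  "('a::complex_banach \<Rightarrow> 'a) \<Rightarrow> (nat \<Rightarrow> complex) \<Rightarrow> (nat \<Rightarrow> 'a) \<Rightarrow> nat \<Rightarrow> bool" where
  "triangular_chain T l v N \<longleftrightarrow>
     (\<forall>j<N. v j \<notin> cspan (v ` {..<j}) \<and> T (v j) - l j *\<^sub>C v j \<in> cspan (v ` {..<j}))"

lemma distance_to_closed_subspace:
  fixes a :: "'a::complex_banach"
  assumes "complex_vector.subspace V" "closed V" "a \<notin> V"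
  shows "\<exists>d>0. \<forall>c w. w \<in> V \<longrightarrow> d * cmod c \<le> norm (c *\<^sub>C a + w)"
proof -
  have "open (- V)" "a \<in> - V" using assms by auto
  then obtain d where d: "d > 0" "ball a d \<subseteq> - V" by (meson openE)
  have "d * cmod c \<le> norm (c *\<^sub>C a + w)" if w: "w \<in> V" for c w
  proof (cases "c = 0")
    case False
    have "- ((1/c) *\<^sub>C w) \<in> V"
      using assms(1) w by (intro complex_vector.subspace_neg complex_vector.subspace_scale)
    then have "- ((1/c) *\<^sub>C w) \<notin> ball a d" using d(2) by blast
    then have "d \<le> norm (a + (1/c) *\<^sub>C w)" by (simp add: dist_norm)
    then have "d * cmod c \<le> norm (a + (1/c) *\<^sub>C w) * cmod c" by (simp add: mult_right_mono)
    also have "\<dots> = norm (c *\<^sub>C (a + (1/c) *\<^sub>C w))" by (simp add: norm_scaleC)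
    also have "c *\<^sub>C (a + (1/c) *\<^sub>C w) = c *\<^sub>C a + w"
      using False by (simp add: scaleC_add_right scaleC_scaleC)
    finally show ?thesis .
  qed auto
  then show ?thesis using d(1) by blast
qed

text \<open>
  Adding a vector \<open>a\<close> outside a closed subspace \<open>V\<close> keeps it closed: by the distance
  estimate the coefficients of \<open>a\<close> in a convergent sequence form a Cauchy sequence.
\<close>

lemma closed_cspan_finite:
  fixes S :: "'a::complex_banach set"
  assumes "finite S"
  shows "closed (cspan S)"
  using assms
proof (induction S)
  case (insert a S)
  show ?case
  proof (cases "a \<in> cspan S")
    case True
    then show ?thesis using insert by (simp add: complex_vector.span_redundant)
  next
    case False
    obtain d where d: "d > 0" "\<And>c w. w \<in> cspan S \<Longrightarrow> d * cmod c \<le> norm (c *\<^sub>C a + w)"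
      using distance_to_closed_subspace[OF complex_vector.subspace_span insert.IH False] by blast
    show ?thesis
      unfolding closed_sequential_limits
    proof (intro allI impI, elim conjE)
      fix x L assume x: "\<forall>n. x n \<in> cspan (insert a S)" and L: "x \<longlonglongrightarrow> L"
      then have "\<forall>n. \<exists>c. x n - c *\<^sub>C a \<in> cspan S" by (simp add: complex_vector.span_breakdown_eq)
      then obtain c where c: "\<And>n. x n - c n *\<^sub>C a \<in> cspan S" by metis
      have dc: "d * cmod (c m - c n) \<le> norm (x m - x n)" for m n
      proof -
        have "(x m - c m *\<^sub>C a) - (x n - c n *\<^sub>C a) \<in> cspan S"
          by (intro complex_vector.span_diff c)
        from d(2)[OF this, of "c m - c n"] show ?thesis
          by (simp add: complex_vector.scale_left_diff_distrib)
      qed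
      have "Cauchy c"
      proof (rule metric_CauchyI)
        fix e :: real assume "e > 0"
        then have "d * e > 0" using d by simp
        then obtain M where M: "\<And>m n. m \<ge> M \<Longrightarrow> n \<ge> M \<Longrightarrow> dist (x m) (x n) < d * e"
          using LIMSEQ_imp_Cauchy[OF L] by (meson metric_CauchyD)
        have "dist (c m) (c n) < e" if "m \<ge> M" "n \<ge> M" for m n
        proof -
          have "d * dist (c m) (c n) < d * e"
            using M[OF that] dc[of m n] by (simp add: dist_norm)
          then show ?thesis using d(1) by simp
        qed
        then show "\<exists>M. \<forall>m\<ge>M. \<forall>n\<ge>M. dist (c m) (c n) < e" by blast
      qed
      then obtain c0 where c0: "c \<longlonglongrightarrow> c0" using Cauchy_convergent convergent_def by blast
      have "(\<lambda>n. cmod (c n - c0) * norm a) \<longlonglongrightarrow> cmod (c0 - c0) * norm a"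
        by (intro tendsto_intros c0)
      then have "(\<lambda>n. norm (c n *\<^sub>C a - c0 *\<^sub>C a)) \<longlonglongrightarrow> 0"
        by (simp add: norm_scaleC flip: complex_vector.scale_left_diff_distrib)
      then have "(\<lambda>n. c n *\<^sub>C a) \<longlonglongrightarrow> c0 *\<^sub>C a"
        by (rule LIM_zero_cancel[OF tendsto_norm_zero_cancel])
      then have "(\<lambda>n. x n - c n *\<^sub>C a) \<longlonglongrightarrow> L - c0 *\<^sub>C a" by (intro tendsto_diff L)
      with insert.IH have "L - c0 *\<^sub>C a \<in> cspan S"
        using c by (meson closed_sequentially)
      then show "L \<in> cspan (insert a S)" unfolding complex_vector.span_breakdown_eq by blast
    qed
  qed
qed simp

lemma triangular_chain_mono:
  "triangular_chain T l v N \<Longrightarrow> j \<le> N \<Longrightarrow> triangular_chain T l v j"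
  by (auto simp: triangular_chain_def)

lemma triangular_chain_invariant:
  fixes T :: "'a::complex_banach \<Rightarrow> 'a"
  assumes T: "bounded_clinear T" and ch: "triangular_chain T l v N"
    and x: "x \<in> cspan (v ` {..<N})"
  shows "T x \<in> cspan (v ` {..<N})"
  using x
proof (induction rule: complex_vector.span_induct_alt)
  case base
  then show ?case using T by (simp add: bounded_clinearD complex_vector.span_zero)
next
  case (step c w y)
  then obtain i where i: "i < N" "w = v i" by auto
  have "T (v i) - l i *\<^sub>C v i \<in> cspan (v ` {..<i})" using ch i by (simp add: triangular_chain_def)
  moreover have "cspan (v ` {..<i}) \<subseteq> cspan (v ` {..<N})"
    using i by (intro complex_vector.span_mono) auto
  ultimately have "T (v i) - l i *\<^sub>C v i \<in> cspan (v ` {..<N})" by blast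
  moreover have "v i \<in> cspan (v ` {..<N})" using i(1) by (intro complex_vector.span_base) auto
  ultimately have "T (v i) - l i *\<^sub>C v i + l i *\<^sub>C v i \<in> cspan (v ` {..<N})"
    by (intro complex_vector.span_add complex_vector.span_scale)
  then show ?case
    using step T i(2) by (simp add: bounded_clinearD complex_vector.span_add complex_vector.span_scale)
qed

lemma triangular_chain_step:
  fixes T :: "'a::complex_banach \<Rightarrow> 'a"
  assumes T: "bounded_clinear T" and ch: "triangular_chain T l v N" and j: "j < N"
    and u: "u - c *\<^sub>C v j \<in> cspan (v ` {..<j})"
  shows "T u - (l j * c) *\<^sub>C v j \<in> cspan (v ` {..<j})"
proof -
  have "T (u - c *\<^sub>C v j) \<in> cspan (v ` {..<j})"
    using triangular_chain_invariant[OF T triangular_chain_mono[OF ch] u] j by simp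
  moreover have "T (v j) - l j *\<^sub>C v j \<in> cspan (v ` {..<j})"
    using ch j by (simp add: triangular_chain_def)
  ultimately have "T (u - c *\<^sub>C v j) + c *\<^sub>C (T (v j) - l j *\<^sub>C v j) \<in> cspan (v ` {..<j})"
    by (intro complex_vector.span_add complex_vector.span_scale)
  then show ?thesis
    using T by (simp add: bounded_clinearD complex_vector.scale_right_diff_distrib scaleC_scaleC mult.commute)
qed

text \<open>
  Modulo the preceding vectors, the iterates of \<open>T\<close> multiply the leading coefficient by the powers
  of the diagonal entry. The separation of lattice points below rests on this
  identity: it is exact, whatever the entries above the diagonal are.
\<close>

lemma triangular_chain_funpow:
  fixes T :: "'a::complex_banach \<Rightarrow> 'a"
  assumes T: "bounded_clinear T" and ch: "triangular_chain T l v N" and j: "j < N"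
    and u: "u - c *\<^sub>C v j \<in> cspan (v ` {..<j})"
  shows "(T ^^ n) u - (l j ^ n * c) *\<^sub>C v j \<in> cspan (v ` {..<j})"
proof (induction n)
  case (Suc n)
  then show ?case using triangular_chain_step[OF T ch j] by (simp add: mult.assoc)
qed (use u in simp)

lemma triangular_chain_separation:
  fixes T :: "'a::complex_banach \<Rightarrow> 'a"
  assumes ch: "triangular_chain T l v N"
  shows "\<exists>d>0. \<forall>j<N. \<forall>c w. w \<in> cspan (v ` {..<j}) \<longrightarrow> d * cmod c \<le> norm (c *\<^sub>C v j + w)"
proof -
  have "\<exists>d>0. \<forall>c w. w \<in> cspan (v ` {..<j}) \<longrightarrow> d * cmod c \<le> norm (c *\<^sub>C v j + w)" if "j < N" for j
    using that ch by (intro distance_to_closed_subspace closed_cspan_finite) (auto simp: triangular_chain_def)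
  then obtain d where d: "\<And>j. j < N \<Longrightarrow> d j > 0"
    "\<And>j c w. j < N \<Longrightarrow> w \<in> cspan (v ` {..<j}) \<Longrightarrow> d j * cmod c \<le> norm (c *\<^sub>C v j + w)"
    by metis
  define e where "e = Min (insert 1 (d ` {..<N}))"
  have "e > 0" using d(1) by (simp add: e_def)
  moreover have "e * cmod c \<le> norm (c *\<^sub>C v j + w)" if "j < N" "w \<in> cspan (v ` {..<j})" for j c w
  proof -
    have "e \<le> d j" using that by (simp add: e_def)
    then have "e * cmod c \<le> d j * cmod c" by (simp add: mult_right_mono)
    with d(2)[OF that] show ?thesis by (meson order_trans)
  qed
  ultimately show ?thesis by blast
qed

lemma gaussian_integers_separated:
  assumes "(a, b) \<noteq> (a', b')"
  shows "1 \<le> cmod (Complex (real a) (real b) - Complex (real a') (real b'))"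
proof -
  have h: "1 \<le> \<bar>real m - real n\<bar>" if "m \<noteq> n" for m n :: nat using that by linarith
  consider "a \<noteq> a'" | "b \<noteq> b'" using assms by blast
  then show ?thesis
    by cases (use h abs_Re_le_cmod[of "Complex (real a) (real b) - Complex (real a') (real b')"]
         abs_Im_le_cmod[of "Complex (real a) (real b) - Complex (real a') (real b')"] in \<open>force+\<close>)
qed

text \<open>
  Take all combinations of the \<open>v j\<close> whose coefficients are Gaussian integers in an
  \<open>m \<times> m\<close> square, scaled so that they lie in the unit ball of \<open>\<nu>\<close>. For two of them
  consider the last coefficient in which they differ: under \<open>T\<^sup>n\<close> it is multiplied by
  \<open>(l j)\<^sup>n\<close>, so their images have a distance of at least a constant times \<open>s\<^sup>n / m\<close>. As long as
  this exceeds \<open>2 \<rho>\<^sup>n\<close>, different combinations need different balls of the cover of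
  the image under \<open>T\<^sup>n\<close>. Each complex coordinate contributes \<open>m\<^sup>2\<close> points.
\<close>

lemma packing_count:
  fixes T :: "'a::complex_banach \<Rightarrow> 'a" and v :: "nat \<Rightarrow> 'a"
  assumes \<nu>: "complex_seminorm \<nu>" and norm_le: "\<And>x. norm x \<le> \<nu> x"
    and T: "bounded_clinear T" and \<rho>: "\<rho> > 0"
    and Y: "finite Y" "\<And>x. \<nu> x \<le> 1 \<Longrightarrow> \<exists>y\<in>Y. \<nu> (T x - y) \<le> \<rho>"
    and ch: "triangular_chain T l v N" and s: "s > 0" "\<And>j. j < N \<Longrightarrow> s \<le> cmod (l j)"
  shows "\<exists>a>0. \<forall>n m. real m < a * (s / \<rho>) ^ n \<longrightarrow> m ^ (2 * N) \<le> card Y ^ n"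
proof -
  obtain d where d: "d > 0"
    "\<And>j c w. j < N \<Longrightarrow> w \<in> cspan (v ` {..<j}) \<Longrightarrow> d * cmod c \<le> norm (c *\<^sub>C v j + w)"
    using triangular_chain_separation[OF ch] by blast
  have \<nu>0: "\<nu> x \<ge> 0" for x using norm_le[of x] norm_ge_zero[of x] by linarith
  have \<nu>_scale: "\<nu> (c *\<^sub>C x) = cmod c * \<nu> x" for c x using \<nu> by (simp add: complex_seminorm_def)
  define S where "S = 1 + (\<Sum>j<N. \<nu> (v j))"
  have S: "S > 0" using \<nu>0 by (simp add: S_def add_pos_nonneg sum_nonneg)
  have Tn: "bounded_clinear (T ^^ n)" for n by (rule bounded_clinear_funpow[OF T])
  show ?thesis
  proof (rule exI[of _ "d / (4 * S)"], intro conjI allI impI)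
    show "d / (4 * S) > 0" using d S by simp
    fix n m :: nat assume m: "real m < d / (4 * S) * (s / \<rho>) ^ n"
    \<comment> \<open>An empty chain is allowed; there the grid consists of one point for every \<open>m\<close>.\<close>
    show "m ^ (2 * N) \<le> card Y ^ n"
    proof (cases "m = 0 \<and> N > 0")
      case True
      then show ?thesis by (simp add: power_0_left)
    next
      case m0: False
      obtain Z where Z: "finite Z" "card Z \<le> card Y ^ n"
        "\<And>x. \<nu> x \<le> 1 \<Longrightarrow> \<exists>z\<in>Z. \<nu> ((T ^^ n) x - z) \<le> \<rho> ^ n"
        using cover_of_iterates[OF \<nu> T \<rho> Y, of n] by blast
      define \<gamma> where "\<gamma> = (\<lambda>(a::nat, b::nat). Complex (real a) (real b) / of_real (2 * real m * S))"
      define G where "G = {..<N} \<rightarrow>\<^sub>E ({..<m} \<times> {..<m})"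
      define x where "x g = (\<Sum>j<N. \<gamma> (g j) *\<^sub>C v j)" for g
      have cardG: "card G = m ^ (2 * N)"
        by (simp add: G_def card_PiE card_cartesian_product power_mult power2_eq_square)
      have "\<nu> (x g) \<le> 1" if g: "g \<in> G" for g
      proof -
        have \<gamma>_le: "cmod (\<gamma> (g j)) \<le> 1 / S" if j: "j < N" for j
        proof -
          obtain a b where ab: "g j = (a, b)" by (cases "g j")
          have "a < m" "b < m" using g j ab by (auto simp: G_def PiE_def Pi_def)
          moreover have "cmod (Complex (real a) (real b)) \<le> real a + real b"
            using cmod_le[of "Complex (real a) (real b)"] by simp
          ultimately have "cmod (Complex (real a) (real b)) \<le> 2 * real m" by simp
          moreover have "cmod (of_real (2 * real m * S)) = 2 * real m * S"
            using S by (simp only: norm_of_real) simp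
          ultimately show ?thesis using S \<open>a < m\<close>
            by (simp add: \<gamma>_def ab norm_divide divide_le_eq del: of_real_mult)
        qed
        have "\<nu> (x g) \<le> (\<Sum>j<N. \<nu> (\<gamma> (g j) *\<^sub>C v j))" unfolding x_def by (rule complex_seminorm_sum[OF \<nu>])
        also have "\<dots> \<le> (\<Sum>j<N. 1 / S * \<nu> (v j))"
          unfolding \<nu>_scale using \<gamma>_le \<nu>0 by (intro sum_mono mult_right_mono) auto
        also have "\<dots> = (S - 1) / S" by (simp add: S_def sum_divide_distrib)
        also have "\<dots> \<le> 1" using S by simp
        finally show ?thesis .
      qed
      then have "\<forall>g\<in>G. \<exists>z\<in>Z. \<nu> ((T ^^ n) (x g) - z) \<le> \<rho> ^ n" using Z(3) by blast
      then obtain z where z: "\<And>g. g \<in> G \<Longrightarrow> z g \<in> Z" "\<And>g. g \<in> G \<Longrightarrow> \<nu> ((T ^^ n) (x g) - z g) \<le> \<rho> ^ n"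
        by metis
      have "inj_on z G"
      proof (rule inj_onI, rule ccontr)
        fix g g' assume g: "g \<in> G" "g' \<in> G" "z g = z g'" "g \<noteq> g'"
        define D where "D = {j. j < N \<and> g j \<noteq> g' j}"
        have "D \<noteq> {}"
        proof
          assume "D = {}"
          then have "g i = g' i" if "i \<in> {..<N}" for i using that by (auto simp: D_def)
          then have "g = g'" by (rule PiE_ext[OF g(1)[unfolded G_def] g(2)[unfolded G_def]])
          with g(4) show False by simp
        qed
        have finD: "finite D" by (simp add: D_def)
        define j where "j = Max D"
        have "j \<in> D" using Max_in[OF finD \<open>D \<noteq> {}\<close>] by (simp add: j_def)
        then have j: "j < N" "g j \<noteq> g' j" by (auto simp: D_def)
        have above: "g i = g' i" if "j < i" "i < N" for i
        proof (rule ccontr)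
          assume "g i \<noteq> g' i"
          then have "i \<in> D" using that by (simp add: D_def)
          then have "i \<le> j" using Max_ge[OF finD] by (simp add: j_def)
          then show False using that by simp
        qed
        define c where "c = \<gamma> (g j) - \<gamma> (g' j)"
        have mpos: "m > 0" using m0 j by auto
        have "1 \<le> cmod (c * of_real (2 * real m * S))"
        proof -
          obtain a b a' b' where ab: "g j = (a, b)" "g' j = (a', b')" by (cases "g j", cases "g' j")
          have "c * of_real (2 * real m * S) = Complex (real a) (real b) - Complex (real a') (real b')"
            using mpos S by (simp add: c_def \<gamma>_def ab field_simps)
          then show ?thesis using gaussian_integers_separated[of a b a' b'] j ab by simp
        qed
        then have c_ge: "1 / (2 * real m * S) \<le> cmod c"
          using mpos S by (simp add: norm_mult divide_le_eq)
        have "x g - x g' = (\<Sum>i<N. (\<gamma> (g i) - \<gamma> (g' i)) *\<^sub>C v i)"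
          by (simp add: x_def sum_subtractf complex_vector.scale_left_diff_distrib)
        also have "\<dots> = (\<Sum>i<Suc j. (\<gamma> (g i) - \<gamma> (g' i)) *\<^sub>C v i)"
          using j(1) above by (intro sum.mono_neutral_right) auto
        finally have "x g - x g' - c *\<^sub>C v j = (\<Sum>i<j. (\<gamma> (g i) - \<gamma> (g' i)) *\<^sub>C v i)"
          by (simp add: c_def)
        also have "\<dots> \<in> cspan (v ` {..<j})"
          by (intro complex_vector.span_sum complex_vector.span_scale complex_vector.span_base) auto
        finally have "(T ^^ n) (x g - x g') - (l j ^ n * c) *\<^sub>C v j \<in> cspan (v ` {..<j})"
          by (rule triangular_chain_funpow[OF T ch j(1)])
        from d(2)[OF j(1) this, of "l j ^ n * c"]
        have "d * cmod (l j ^ n * c) \<le> norm ((T ^^ n) (x g) - (T ^^ n) (x g'))"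
          using Tn[of n] by (simp add: bounded_clinearD)
        also have "\<dots> \<le> \<nu> (((T ^^ n) (x g) - z g) - ((T ^^ n) (x g') - z g))"
          using norm_le by (metis diff_diff_eq2 diff_add_cancel)
        also have "\<dots> \<le> \<rho> ^ n + \<rho> ^ n"
          using z(2)[OF g(1)] z(2)[OF g(2)] g(3) complex_seminorm_diff[OF \<nu>, of "(T ^^ n) (x g) - z g" "(T ^^ n) (x g') - z g"]
          by simp
        finally have up: "d * (cmod (l j) ^ n * cmod c) \<le> 2 * \<rho> ^ n" by (simp add: norm_mult norm_power)
        have "d * (s ^ n * (1 / (2 * real m * S))) \<le> d * (cmod (l j) ^ n * cmod c)"
          using d(1) s(1) s(2)[OF j(1)] c_ge mpos S by (intro mult_left_mono mult_mono power_mono) auto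
        with up have "d * (s ^ n * (1 / (2 * real m * S))) \<le> 2 * \<rho> ^ n" by simp
        then have "d * s ^ n \<le> 4 * real m * S * \<rho> ^ n" using mpos S by (simp add: field_simps)
        moreover have "4 * real m * S * \<rho> ^ n < d * s ^ n"
          using m S \<rho> by (simp add: field_simps power_divide)
        ultimately show False by simp
      qed
      then have "card G \<le> card Z" using z(1) Z(1) by (intro card_inj_on_le[of z]) auto
      then show ?thesis using cardG Z(2) by simp
    qed
  qed
qed

text \<open>
  The grid parameter \<open>m\<close> may grow like a constant times \<open>(s / \<rho>)\<^sup>n\<close>; comparing exponential
  growth rates in \<open>n\<close> removes the constant. The estimate plays the role of comparing the
  volume of a ball with that of its image.
\<close>

lemma modulus_le_entropy:
  fixes T :: "'a::complex_banach \<Rightarrow> 'a" and v :: "nat \<Rightarrow> 'a"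
  assumes \<nu>: "complex_seminorm \<nu>" and norm_le: "\<And>x. norm x \<le> \<nu> x"
    and T: "bounded_clinear T" and \<rho>: "\<rho> > 0"
    and Y: "finite Y" "\<And>x. \<nu> x \<le> 1 \<Longrightarrow> \<exists>y\<in>Y. \<nu> (T x - y) \<le> \<rho>"
    and ch: "triangular_chain T l v N" and s: "s > 0" "\<And>j. j < N \<Longrightarrow> s \<le> cmod (l j)"
  shows "(s / \<rho>) ^ (2 * N) \<le> real (card Y)"
proof (rule ccontr)
  assume neg: "\<not> (s / \<rho>) ^ (2 * N) \<le> real (card Y)"
  define \<tau> where "\<tau> = s / \<rho>"
  define q where "q = real (card Y)"
  have \<tau>0: "\<tau> > 0" using s \<rho> by (simp add: \<tau>_def)
  have "\<nu> 0 = 0" using \<nu> unfolding complex_seminorm_def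
    by (metis complex_vector.scale_zero_left mult_zero_left norm_zero)
  then have "Y \<noteq> {}" using Y(2)[of 0] by auto
  then have "card Y > 0" using Y(1) by (simp add: card_gt_0_iff)
  then have q1: "q \<ge> 1" unfolding q_def by simp
  have big: "\<tau> ^ (2 * N) > q" using neg by (simp add: \<tau>_def q_def)
  have \<tau>1: "\<tau> > 1"
    using big q1 \<tau>0 power_le_one[of \<tau> "2 * N"] by linarith
  define \<theta> where "\<theta> = \<tau> ^ (2 * N) / q"
  have \<theta>: "\<theta> > 1" using big q1 by (simp add: \<theta>_def)
  obtain a where a: "a > 0" "\<And>n m. real m < a * \<tau> ^ n \<Longrightarrow> m ^ (2 * N) \<le> card Y ^ n"
    using packing_count[OF assms] unfolding \<tau>_def by blast
  obtain n1 where n1: "2 / a < \<tau> ^ n1" using real_arch_pow[OF \<tau>1] by blast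
  obtain n2 where n2: "1 / (a / 2) ^ (2 * N) < \<theta> ^ n2" using real_arch_pow[OF \<theta>] by blast
  define n where "n = max n1 n2"
  have "\<tau> ^ n1 \<le> \<tau> ^ n" using \<tau>1 by (intro power_increasing) (auto simp: n_def)
  with n1 have "2 / a < \<tau> ^ n" by linarith
  then have n1': "2 < a * \<tau> ^ n" using a(1) by (simp add: field_simps)
  have "\<theta> ^ n2 \<le> \<theta> ^ n" using \<theta> by (intro power_increasing) (auto simp: n_def)
  with n2 have "1 / (a / 2) ^ (2 * N) < \<theta> ^ n" by linarith
  then have n2': "1 < (a / 2) ^ (2 * N) * \<theta> ^ n" using a(1) by (simp add: divide_less_eq mult.commute)
  define m where "m = nat (\<lceil>a * \<tau> ^ n\<rceil> - 1)"
  have m: "real m < a * \<tau> ^ n" "a * \<tau> ^ n - 1 \<le> real m" using n1' unfolding m_def by linarith+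
  have "(a / 2 * \<tau> ^ n) ^ (2 * N) \<le> real m ^ (2 * N)"
    using m(2) n1' a(1) \<tau>0 by (intro power_mono) auto
  also have "\<dots> = real (m ^ (2 * N))" by simp
  also have "\<dots> \<le> real (card Y ^ n)" by (rule of_nat_mono[OF a(2)[OF m(1)]])
  also have "\<dots> = q ^ n" by (simp add: q_def)
  finally have "(a / 2) ^ (2 * N) * (\<tau> ^ (2 * N)) ^ n \<le> q ^ n"
    by (simp add: power_mult_distrib power_divide mult.commute flip: power_mult)
  then have "(a / 2) ^ (2 * N) * \<theta> ^ n \<le> 1"
    using q1 by (simp add: \<theta>_def power_divide divide_le_eq mult.commute)
  with n2' show False by simp
qed

section \<open>Triangular chains from root spaces\<close>

lemma bounded_clinear_shift:
  assumes "bounded_clinear T"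
  shows "bounded_clinear (\<lambda>y. z *\<^sub>C y - T y)"
  using bounded_clinear_add[OF bounded_clinear_scaleC[OF bounded_clinear_id, of z]
      bounded_clinear_scaleC[OF assms, of "-1"]]
  by simp

lemma subspace_root_space:
  fixes T :: "'a::complex_banach \<Rightarrow> 'a"
  assumes T: "bounded_clinear T"
  shows "complex_vector.subspace (root_space T z)"
proof -
  let ?S = "\<lambda>y. z *\<^sub>C y - T y"
  note lin = bounded_clinearD[OF bounded_clinear_funpow[OF bounded_clinear_shift[OF T]]]
  have more: "(?S ^^ m) x = 0" if "(?S ^^ k) x = 0" "k \<le> m" for k m x
  proof -
    have "(?S ^^ m) x = (?S ^^ (m - k)) ((?S ^^ k) x)"
      using that(2) by (simp add: funpow_add[symmetric, THEN fun_cong, unfolded o_def])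
    then show ?thesis by (simp add: that lin)
  qed
  show ?thesis
  proof (rule complex_vector.subspaceI)
    show "0 \<in> root_space T z" by (auto simp: root_space_def lin intro: exI[of _ "0::nat"])
    show "x + y \<in> root_space T z" if "x \<in> root_space T z" "y \<in> root_space T z" for x y
    proof -
      from that obtain k k' where "(?S ^^ k) x = 0" "(?S ^^ k') y = 0" by (auto simp: root_space_def)
      then have "(?S ^^ max k k') (x + y) = 0"
        using more[of k x "max k k'"] more[of k' y "max k k'"] by (simp add: lin)
      then show ?thesis by (auto simp: root_space_def)
    qed
    show "c *\<^sub>C x \<in> root_space T z" if "x \<in> root_space T z" for c x
      using that by (auto simp: root_space_def lin)
  qed
qed

text \<open>
  On the span of a chain, \<open>z - T\<close> is triangular with nonzero diagonal entries \<open>z - l j\<close>.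
\<close>

lemma triangular_chain_shift_injective:
  fixes T :: "'a::complex_banach \<Rightarrow> 'a"
  assumes T: "bounded_clinear T" and "triangular_chain T l v N" and "\<And>j. j < N \<Longrightarrow> l j \<noteq> z"
    and "x \<in> cspan (v ` {..<N})" and "z *\<^sub>C x - T x = 0"
  shows "x = 0"
  using assms(2-)
proof (induction N)
  case (Suc N)
  from Suc.prems(3) obtain c where c: "x - c *\<^sub>C v N \<in> cspan (v ` {..<N})"
    by (auto simp: lessThan_Suc complex_vector.span_breakdown_eq)
  have "T x - (l N * c) *\<^sub>C v N \<in> cspan (v ` {..<N})"
    by (rule triangular_chain_step[OF T Suc.prems(1) _ c]) simp
  then have "z *\<^sub>C (x - c *\<^sub>C v N) - (T x - (l N * c) *\<^sub>C v N) \<in> cspan (v ` {..<N})"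
    by (rule complex_vector.span_diff[OF complex_vector.span_scale[OF c]])
  moreover have "z *\<^sub>C (x - c *\<^sub>C v N) - (T x - (l N * c) *\<^sub>C v N) = ((l N - z) * c) *\<^sub>C v N"
    using Suc.prems(4) by (simp add: complex_vector.scale_right_diff_distrib scaleC_scaleC
        complex_vector.scale_left_diff_distrib left_diff_distrib algebra_simps)
  ultimately have in_span: "((l N - z) * c) *\<^sub>C v N \<in> cspan (v ` {..<N})" by simp
  have "c = 0"
  proof (rule ccontr)
    assume "c \<noteq> 0"
    then have nz: "(l N - z) * c \<noteq> 0" using Suc.prems(2)[of N] by simp
    have "(1 / ((l N - z) * c)) *\<^sub>C ((l N - z) * c) *\<^sub>C v N \<in> cspan (v ` {..<N})"
      by (rule complex_vector.span_scale[OF in_span])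
    then have "v N \<in> cspan (v ` {..<N})" using nz by (simp add: scaleC_scaleC)
    then show False using Suc.prems(1) by (simp add: triangular_chain_def)
  qed
  then have "x \<in> cspan (v ` {..<N})" using c by simp
  then show ?case using Suc by (intro Suc.IH triangular_chain_mono[OF Suc.prems(1)]) auto
qed simp

lemma triangular_chain_Int_root_space:
  fixes T :: "'a::complex_banach \<Rightarrow> 'a"
  assumes T: "bounded_clinear T" and ch: "triangular_chain T l v N" and l: "\<And>j. j < N \<Longrightarrow> l j \<noteq> z"
    and x: "x \<in> cspan (v ` {..<N})" "x \<in> root_space T z"
  shows "x = 0"
proof -
  let ?S = "\<lambda>y. z *\<^sub>C y - T y"
  have "x = 0" if "(?S ^^ k) x = 0" for k using that x(1)
  proof (induction k arbitrary: x)
    case (Suc k)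
    have "(?S ^^ k) (?S x) = 0" using Suc.prems(1) by (simp only: funpow_Suc_right o_apply)
    moreover have "?S x \<in> cspan (v ` {..<N})"
      using triangular_chain_invariant[OF T ch Suc.prems(2)] Suc.prems(2)
      by (intro complex_vector.span_diff complex_vector.span_scale)
    ultimately have "?S x = 0" by (rule Suc.IH)
    then show ?case using triangular_chain_shift_injective[OF T ch _ Suc.prems(2)] l by blast
  qed simp
  then show ?thesis using x(2) by (auto simp: root_space_def)
qed

text \<open>
  Apply \<open>z - T\<close> to \<open>x\<close> until the result enters \<open>V\<close>; the last vector before that is
  an eigenvector modulo \<open>V\<close>.
\<close>

lemma root_vector_modulo_subspace:
  fixes T :: "'a::complex_banach \<Rightarrow> 'a"
  assumes T: "bounded_clinear T" and V: "complex_vector.subspace V" and x: "x \<in> root_space T z" "x \<notin> V"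
  shows "\<exists>u \<in> root_space T z. u \<notin> V \<and> T u - z *\<^sub>C u \<in> V"
proof -
  let ?S = "\<lambda>y. z *\<^sub>C y - T y"
  note lin = bounded_clinearD[OF bounded_clinear_funpow[OF bounded_clinear_shift[OF T]]]
  obtain k where k: "(?S ^^ k) x = 0" using x(1) by (auto simp: root_space_def)
  then have ex: "(?S ^^ k) x \<in> V" using V by (simp add: complex_vector.subspace_0)
  define m where "m = (LEAST m. (?S ^^ m) x \<in> V)"
  have m: "(?S ^^ m) x \<in> V" unfolding m_def using ex by (rule LeastI)
  have "m \<noteq> 0" using m x(2) by (cases m) auto
  then obtain i where i: "m = Suc i" by (cases m) auto
  define u where "u = (?S ^^ i) x"
  have "u \<notin> V" using not_less_Least[of i "\<lambda>m. (?S ^^ m) x \<in> V"] i by (simp add: u_def m_def)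
  moreover have "T u - z *\<^sub>C u \<in> V"
    using complex_vector.subspace_neg[OF V m] by (simp add: i u_def)
  moreover have "(?S ^^ k) u = 0"
  proof -
    have "(?S ^^ k) u = (?S ^^ (k + i)) x" by (simp add: u_def funpow_add)
    also have "\<dots> = (?S ^^ i) ((?S ^^ k) x)" by (simp add: add.commute[of k] funpow_add)
    finally show ?thesis by (simp add: k lin)
  qed
  ultimately show ?thesis by (auto simp: root_space_def)
qed

text \<open>
  As long as fewer than \<open>alg_mult T z\<close> root vectors have been added, the root space is not
  contained in the current span: it meets the span of the old chain only in \<open>0\<close>, so
  otherwise it would be spanned by the added vectors alone. Hence a further root vector
  can be found that is an eigenvector modulo the current span.
\<close>

lemma triangular_chain_extend:
  fixes T :: "'a::complex_banach \<Rightarrow> 'a"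
  assumes T: "bounded_clinear T" and ch: "triangular_chain T l v N" and l: "\<And>j. j < N \<Longrightarrow> l j \<noteq> z"
    and "i \<le> alg_mult T z"
  shows "\<exists>l' v'. triangular_chain T l' v' (N + i) \<and> (\<forall>j<N. l' j = l j \<and> v' j = v j) \<and>
    (\<forall>j\<in>{N..<N + i}. l' j = z \<and> v' j \<in> root_space T z)"
  using assms(4)
proof (induction i)
  case 0
  then show ?case using ch by (intro exI[of _ l] exI[of _ v]) auto
next
  case (Suc i)
  then obtain l' v' where ch': "triangular_chain T l' v' (N + i)"
    and low: "\<And>j. j < N \<Longrightarrow> l' j = l j \<and> v' j = v j"
    and high: "\<And>j. j \<in> {N..<N + i} \<Longrightarrow> l' j = z \<and> v' j \<in> root_space T z"
    by (meson Suc_leD)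
  define W where "W = cspan (v' ` {N..<N + i})"
  have W: "W \<subseteq> root_space T z"
    unfolding W_def using high by (intro complex_vector.span_minimal subspace_root_space[OF T]) auto
  have "\<not> root_space T z \<subseteq> cspan (v' ` {..<N + i})"
  proof
    assume sub: "root_space T z \<subseteq> cspan (v' ` {..<N + i})"
    have "root_space T z \<subseteq> W"
    proof
      fix w assume w: "w \<in> root_space T z"
      have "{..<N + i} = {..<N} \<union> {N..<N + i}" by auto
      then have "w \<in> cspan (v' ` {..<N} \<union> v' ` {N..<N + i})" using sub w by (metis image_Un subsetD)
      then obtain a b where ab: "w = a + b" "a \<in> cspan (v' ` {..<N})" "b \<in> W"
        unfolding complex_vector.span_Un W_def by blast
      have "a = w - b" using ab(1) by simp
      then have "a \<in> root_space T z"
        using w ab(3) W by (auto intro: complex_vector.subspace_diff[OF subspace_root_space[OF T]])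
      then have "a = 0"
        using triangular_chain_Int_root_space[OF T triangular_chain_mono[OF ch'], of N z a] ab(2) low l by simp
      then show "w \<in> W" using ab by simp
    qed
    then have "alg_mult T z \<le> card (v' ` {N..<N + i})"
      unfolding alg_mult_def W_def by (intro complex_vector.dim_le_card) auto
    also have "\<dots> \<le> card {N..<N + i}" by (intro card_image_le) auto
    finally show False using Suc.prems by simp
  qed
  then obtain x where "x \<in> root_space T z" "x \<notin> cspan (v' ` {..<N + i})" by blast
  from root_vector_modulo_subspace[OF T complex_vector.subspace_span this]
  obtain u where u: "u \<in> root_space T z" "u \<notin> cspan (v' ` {..<N + i})"
    "T u - z *\<^sub>C u \<in> cspan (v' ` {..<N + i})" by blast
  have im: "(v'(N + i := u)) ` {..<j} = v' ` {..<j}" if "j \<le> N + i" for j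
    using that by (intro image_cong) auto
  have "triangular_chain T (l'(N + i := z)) (v'(N + i := u)) (N + Suc i)"
    unfolding triangular_chain_def
  proof (intro allI impI)
    fix j assume "j < N + Suc i"
    then consider "j < N + i" | "j = N + i" by linarith
    then show "(v'(N + i := u)) j \<notin> cspan ((v'(N + i := u)) ` {..<j}) \<and>
      T ((v'(N + i := u)) j) - (l'(N + i := z)) j *\<^sub>C (v'(N + i := u)) j \<in> cspan ((v'(N + i := u)) ` {..<j})"
    proof cases
      case 1
      then have "j \<noteq> N + i" "j \<le> N + i" by simp_all
      with 1 ch' show ?thesis unfolding triangular_chain_def by (simp only: im fun_upd_other simp_thms)
    next
      case 2
      with u show ?thesis by (simp only: im fun_upd_same simp_thms order_refl)
    qed
  qed
  moreover have "\<forall>j<N. (l'(N + i := z)) j = l j \<and> (v'(N + i := u)) j = v j"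
    using low by simp
  moreover have "\<forall>j\<in>{N..<N + Suc i}. (l'(N + i := z)) j = z \<and> (v'(N + i := u)) j \<in> root_space T z"
    using high u(1) by (auto simp: less_Suc_eq)
  ultimately show ?case by blast
qed

lemma triangular_chain_of_eigenvalues:
  fixes T :: "'a::complex_banach \<Rightarrow> 'a"
  assumes T: "bounded_clinear T" and "finite Z"
  shows "\<exists>l v. triangular_chain T l v (\<Sum>z\<in>Z. alg_mult T z) \<and> (\<forall>j<(\<Sum>z\<in>Z. alg_mult T z). l j \<in> Z)"
  using assms(2)
proof induction
  case empty
  then show ?case by (simp add: triangular_chain_def)
next
  case (insert z Z)
  let ?N = "\<Sum>z\<in>Z. alg_mult T z"
  obtain l v where ch: "triangular_chain T l v ?N" and l: "\<And>j. j < ?N \<Longrightarrow> l j \<in> Z"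
    using insert.IH by blast
  have "\<And>j. j < ?N \<Longrightarrow> l j \<noteq> z" using l insert.hyps(2) by blast
  from triangular_chain_extend[OF T ch this order_refl]
  obtain l' v' where *: "triangular_chain T l' v' (?N + alg_mult T z)"
    "\<And>j. j < ?N \<Longrightarrow> l' j = l j" "\<And>j. j \<in> {?N..<?N + alg_mult T z} \<Longrightarrow> l' j = z" by metis
  have "l' j \<in> insert z Z" if "j < ?N + alg_mult T z" for j
    using *(2)[of j] *(3)[of j] l[of j] that by (cases "j < ?N") auto
  then show ?case using *(1) insert.hyps by (auto simp: add.commute)
qed

section \<open>Counting eigenvalues by entropy numbers\<close>

lemma entropy_number_nonneg:
  fixes K :: "'a::complex_banach \<Rightarrow> 'a"
  assumes K: "bounded_clinear K"
  shows "entropy_number k K \<ge> 0"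
  unfolding entropy_number_def
proof (rule cInf_greatest)
  show "{\<epsilon>. \<epsilon> > 0 \<and> (\<exists>q y. q \<le> (2::nat) ^ (k - 1) \<and> K ` cball 0 1 \<subseteq> (\<Union>i\<in>{1..q}. cball (y i) \<epsilon>))} \<noteq> {}"
    by (rule entropy_number_radii_nonempty[OF K])
qed auto

text \<open>
  In the adapted norm \<open>A\<close> maps the unit ball into the ball of radius \<open>r\<close>, so a cover of the image
  under \<open>K\<close> by \<open>\<epsilon>\<close>-balls yields a cover of the image under \<open>A + K\<close> by equally many balls of
  radius \<open>r + power_bound A r * \<epsilon>\<close>.
\<close>

lemma root_spaces_entropy_bound:
  fixes A K :: "'a::complex_banach \<Rightarrow> 'a"
  assumes A: "bounded_clinear A" and K: "bounded_clinear K" and r: "r > spectral_radius A"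
    and e: "entropy_number k K \<le> \<eta>" and \<eta>: "\<eta> \<ge> 0"
    and Z: "finite Z" "\<And>z. z \<in> Z \<Longrightarrow> s \<le> cmod z" and s: "s > 0"
  shows "(s / (r + power_bound A r * \<eta>)) ^ (2 * (\<Sum>z\<in>Z. alg_mult (\<lambda>x. A x + K x) z)) \<le> 2 ^ (k - 1)"
    (is "(s / (r + ?M * \<eta>)) ^ (2 * ?N) \<le> _")
proof -
  have r0: "r > 0" using r spectral_radius_nonneg[OF A] by simp
  have M0: "?M \<ge> 0" by (rule power_bound_nonneg[OF A r])
  let ?T = "\<lambda>x. A x + K x"
  have T: "bounded_clinear ?T" by (rule bounded_clinear_add[OF A K])
  obtain l v where ch: "triangular_chain ?T l v ?N" and l: "\<And>j. j < ?N \<Longrightarrow> l j \<in> Z"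
    using triangular_chain_of_eigenvalues[OF T Z(1)] by blast
  obtain \<nu> where \<nu>: "complex_seminorm \<nu>" "\<And>x. norm x \<le> \<nu> x" "\<And>x. \<nu> x \<le> ?M * norm x"
    "\<And>x. \<nu> (A x) \<le> r * \<nu> x" using adapted_norm[OF A r] by blast
  \<comment> \<open>The infimum that defines the entropy number need not be attained, hence the detour
  over \<open>\<epsilon> > \<eta>\<close> and a limit.\<close>
  have *: "(s / (r + ?M * \<epsilon>)) ^ (2 * ?N) \<le> 2 ^ (k - 1)" if \<epsilon>: "\<eta> < \<epsilon>" for \<epsilon>
  proof -
    obtain Y where Y: "finite Y" "card Y \<le> 2 ^ (k - 1)"
      "\<And>x. norm x \<le> 1 \<Longrightarrow> \<exists>y\<in>Y. norm (K x - y) \<le> \<epsilon>"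
      using entropy_number_cover[OF K, of k \<epsilon>] e \<epsilon> by auto
    have "\<exists>y\<in>Y. \<nu> (A x + K x - y) \<le> r + ?M * \<epsilon>" if x: "\<nu> x \<le> 1" for x
    proof -
      have "norm x \<le> 1" using \<nu>(2)[of x] x by simp
      then obtain y where y: "y \<in> Y" "norm (K x - y) \<le> \<epsilon>" using Y(3) by blast
      have "\<nu> (A x + K x - y) = \<nu> (A x + (K x - y))" by (simp add: algebra_simps)
      also have "\<dots> \<le> \<nu> (A x) + \<nu> (K x - y)" using \<nu>(1) by (simp only: complex_seminorm_def)
      also have "\<dots> \<le> r * \<nu> x + ?M * norm (K x - y)" by (intro add_mono \<nu>)
      also have "\<dots> \<le> r * 1 + ?M * \<epsilon>" using x y(2) r0 M0 by (intro add_mono mult_left_mono) auto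
      finally show ?thesis using y(1) by auto
    qed
    moreover have "r + ?M * \<epsilon> > 0" using r0 M0 \<eta> \<epsilon> by (simp add: add_pos_nonneg)
    ultimately have "(s / (r + ?M * \<epsilon>)) ^ (2 * ?N) \<le> real (card Y)"
      using l Z(2) by (intro modulus_le_entropy[OF \<nu>(1,2) T _ Y(1) _ ch s]) auto
    also have "\<dots> \<le> 2 ^ (k - 1)" using of_nat_mono[OF Y(2), where 'a = real] by simp
    finally show ?thesis .
  qed
  have "r + ?M * \<eta> > 0" using r0 M0 \<eta> by (simp add: add_pos_nonneg)
  then have "((\<lambda>\<epsilon>. (s / (r + ?M * \<epsilon>)) ^ (2 * ?N)) \<longlongrightarrow> (s / (r + ?M * \<eta>)) ^ (2 * ?N)) (at_right \<eta>)"
    by (intro tendsto_intros) auto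
  moreover have "eventually (\<lambda>\<epsilon>. (s / (r + ?M * \<epsilon>)) ^ (2 * ?N) \<le> 2 ^ (k - 1)) (at_right \<eta>)"
    using eventually_at_right_less[of \<eta>] by eventually_elim (rule *)
  ultimately show ?thesis by (intro tendsto_upperbound) auto
qed

text \<open>
  Taking logarithms, \<open>2 N ln (s / (r + \<eta>)) \<le> (k - 1) ln 2\<close> with
  \<open>\<eta> = M \<kappa> k\<^bsup>-1/p\<^esup>\<close>. With \<open>k\<close> as small as \<open>\<eta> \<le> \<theta> (s - r)\<close> permits and
  \<open>ln u \<ge> 1 - 1/u\<close>, the bound for \<open>N\<close> becomes a constant divided by
  \<open>\<theta>\<^sup>p (1 - \<theta>)\<close>. This is smallest for \<open>\<theta> = p / (p + 1)\<close>, which produces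
  \<open>entropy_const p\<close>.
\<close>

lemma optimise_entropy_bound:
  fixes M \<kappa> p r s :: real and N :: nat
  assumes p: "p > 0" and M: "M \<ge> 0" and \<kappa>: "\<kappa> \<ge> 0" and r: "0 < r" "r < s"
    and bound: "\<And>k::nat. k \<ge> 1 \<Longrightarrow> (s / (r + M * (\<kappa> * real k powr (- 1 / p)))) ^ (2 * N) \<le> 2 ^ (k - 1)"
  shows "real N \<le> entropy_const p * (s * M powr p / (s - r) powr (p + 1)) * \<kappa> powr p"
proof -
  define b where "b = p / (p + 1) * (s - r)"
  have b: "b > 0" using p r by (simp add: b_def)
  define X where "X = (M * \<kappa> / b) powr p"
  \<comment> \<open>The maximum with \<open>1\<close> matters only for \<open>M \<kappa> = 0\<close>, where \<open>X = 0\<close>. In every case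
  \<open>k - 1 \<le> X\<close>: the exponent \<open>k - 1\<close> absorbs the rounding.\<close>
  define k where "k = max 1 (nat \<lceil>X\<rceil>)"
  have X0: "X \<ge> 0" by (simp add: X_def)
  have k: "k \<ge> 1" "X \<le> real k" "real k - 1 \<le> X" using X0 unfolding k_def by linarith+
  define \<eta> where "\<eta> = M * (\<kappa> * real k powr (- 1 / p))"
  have \<eta>0: "\<eta> \<ge> 0" using M \<kappa> by (simp add: \<eta>_def)
  have "M * \<kappa> / b = X powr (1 / p)"
    using p b M \<kappa> by (simp add: X_def powr_powr)
  also have "\<dots> \<le> real k powr (1 / p)" using X0 k p by (intro powr_mono2) auto
  finally have "M * \<kappa> \<le> b * real k powr (1 / p)" using b by (simp add: field_simps)
  then have \<eta>b: "\<eta> \<le> b"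
    using k by (simp add: \<eta>_def powr_minus field_simps)
  define u where "u = s / (r + \<eta>)"
  have u0: "u > 0" using r \<eta>0 by (simp add: u_def)
  have "(s - r) / (p + 1) / s = (s - r - b) / s"
    using p r by (simp add: b_def field_simps)
  also have "\<dots> \<le> (s - r - \<eta>) / s" using \<eta>b r by (intro divide_right_mono) auto
  also have "\<dots> = 1 - 1 / u" using r by (simp add: u_def field_simps)
  also have "\<dots> \<le> ln u" using ln_le_minus_one[of "1 / u"] u0 by (simp add: ln_div)
  finally have lnu: "(s - r) / (p + 1) / s \<le> ln u" .
  have "ln (u ^ (2 * N)) \<le> ln (2 ^ (k - 1))"
    using bound[OF k(1)] u0 by (intro ln_mono) (auto simp: u_def \<eta>_def)
  then have "2 * real N * ln u \<le> (real k - 1) * ln 2"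
    using u0 k(1) by (simp add: ln_realpow of_nat_diff)
  also have "\<dots> \<le> X * ln 2" using k(3) by (intro mult_right_mono) auto
  finally have "2 * real N * ((s - r) / (p + 1) / s) \<le> X * ln 2"
    using mult_left_mono[OF lnu, of "2 * real N"] by simp
  moreover have "(s - r) / (p + 1) / s > 0" using p r by simp
  ultimately have "real N \<le> X * ln 2 / (2 * ((s - r) / (p + 1) / s))"
    by (subst pos_le_divide_eq) (simp_all only: mult_ac mult_pos_pos zero_less_numeral)
  also have "\<dots> = X * ln 2 * (p + 1) * s / (2 * (s - r))" by simp
  also have "\<dots> = entropy_const p * (s * M powr p / (s - r) powr (p + 1)) * \<kappa> powr p"
  proof -
    have "X = M powr p * \<kappa> powr p * (p + 1) powr p / (p powr p * (s - r) powr p)"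
      using p r M \<kappa> by (simp add: X_def b_def powr_divide powr_mult)
    moreover have "(p + 1) powr (p + 1) = (p + 1) powr p * (p + 1)"
      "(s - r) powr (p + 1) = (s - r) powr p * (s - r)"
      using p r by (simp_all add: powr_add)
    ultimately show ?thesis by (simp add: entropy_const_def mult_ac)
  qed
  finally show ?thesis .
qed

lemma entropy_quasinorm_bounds:
  fixes K :: "'a::complex_banach \<Rightarrow> 'a"
  assumes "K \<in> entropy_class p"
  shows "0 \<le> entropy_quasinorm p K"
    and "k \<ge> 1 \<Longrightarrow> entropy_number k K \<le> entropy_quasinorm p K * real k powr (- 1 / p)"
proof -
  have upper: "real k powr (1 / p) * entropy_number k K \<le> entropy_quasinorm p K" if "k \<ge> 1" for k
    using assms that unfolding entropy_quasinorm_def entropy_class_def by (intro cSUP_upper) auto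
  have "0 \<le> entropy_number 1 K" using assms by (simp add: entropy_class_def entropy_number_nonneg)
  then show "0 \<le> entropy_quasinorm p K" using upper[of 1] by simp
  show "entropy_number k K \<le> entropy_quasinorm p K * real k powr (- 1 / p)" if "k \<ge> 1"
    using upper[OF that] that by (simp add: powr_minus field_simps)
qed

lemma alg_mult_sum_le:
  fixes A K :: "'a::complex_banach \<Rightarrow> 'a"
  assumes A: "bounded_clinear A" and p: "p > 0" and K: "K \<in> entropy_class p"
    and r: "spectral_radius A < r" "r < s" and Z: "finite Z" "\<And>z. z \<in> Z \<Longrightarrow> s \<le> cmod z"
  shows "real (\<Sum>z\<in>Z. alg_mult (\<lambda>x. A x + K x) z)
    \<le> entropy_const p * (s * power_bound A r powr p / (s - r) powr (p + 1)) * entropy_quasinorm p K powr p"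
proof (rule optimise_entropy_bound[OF p power_bound_nonneg[OF A r(1)] entropy_quasinorm_bounds(1)[OF K] _ r(2)])
  have Kc: "bounded_clinear K" using K by (simp add: entropy_class_def)
  show "0 < r" using r spectral_radius_nonneg[OF A] by simp
  then have "0 < s" using r by simp
  then show "(s / (r + power_bound A r * (entropy_quasinorm p K * real k powr (- 1 / p)))) ^
      (2 * (\<Sum>z\<in>Z. alg_mult (\<lambda>x. A x + K x) z)) \<le> 2 ^ (k - 1)" if "k \<ge> 1" for k
    using entropy_quasinorm_bounds[OF K] that
    by (intro root_spaces_entropy_bound[OF A Kc r(1) _ _ Z]) auto
qed

text \<open>
  The count is the supremum of its finite partial sums, so a uniform bound for these also excludes
  infinitely many eigenvalues.
\<close>

lemma eigenvalue_count_le: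
  assumes "\<And>Z. finite Z \<Longrightarrow> (\<And>z. z \<in> Z \<Longrightarrow> s \<le> cmod z) \<Longrightarrow> real (\<Sum>z\<in>Z. alg_mult T z) \<le> c"
  shows "eigenvalue_count T s \<le> ennreal c"
  unfolding eigenvalue_count_def
proof (rule infsum_le_finite_sums)
  fix F assume F: "finite F" "F \<subseteq> {z \<in> discrete_spectrum T. s < cmod z}"
  then have "real (\<Sum>z\<in>F. alg_mult T z) \<le> c" by (intro assms) (auto simp: less_imp_le)
  then have "ennreal (real (\<Sum>z\<in>F. alg_mult T z)) \<le> ennreal c" by (rule ennreal_leI)
  then show "(\<Sum>z\<in>F. of_nat (alg_mult T z)) \<le> ennreal c"
    by (simp flip: ennreal_of_nat_eq_real_of_nat del: of_nat_sum add: of_nat_sum[symmetric])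
qed (rule nonneg_summable_on_complete, simp)

theorem theorem2:
  fixes A K :: "'a::complex_banach \<Rightarrow> 'a" and p :: real
  assumes "bounded_clinear A"
    and "p > 0"
    and "K \<in> entropy_class p"
  shows "(\<forall>s > spectral_radius A.
            eigenvalue_count (\<lambda>x. A x + K x) s
              \<le> ennreal (entropy_const p
                  * (INF r\<in>{spectral_radius A<..<s}.
                       s * power_bound A r powr p / (s - r) powr (p + 1))
                  * entropy_quasinorm p K powr p))
       \<and> (\<forall>s > spectral_radius A.
            eigenvalue_count (\<lambda>x. A x + K x) s
              \<le> ennreal (2 powr (p + 1) * entropy_const p
                  * (s * power_bound A ((s + spectral_radius A) / 2) powr p
                       / (s - spectral_radius A) powr (p + 1))
                  * entropy_quasinorm p K powr p))"
proof (intro conjI allI impI)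
  let ?g = "\<lambda>s r. s * power_bound A r powr p / (s - r) powr (p + 1)"
  note main = alg_mult_sum_le[OF assms]
  fix s assume s: "s > spectral_radius A"
  show "eigenvalue_count (\<lambda>x. A x + K x) s \<le> ennreal (entropy_const p
          * (INF r\<in>{spectral_radius A<..<s}. ?g s r) * entropy_quasinorm p K powr p)"
  proof (rule eigenvalue_count_le)
    fix Z assume Z: "finite Z" "\<And>z. z \<in> Z \<Longrightarrow> s \<le> cmod z"
    let ?N = "real (\<Sum>z\<in>Z. alg_mult (\<lambda>x. A x + K x) z)"
    define c where "c = entropy_const p * entropy_quasinorm p K powr p"
    have c0: "c \<ge> 0" using assms(2) by (simp add: c_def entropy_const_def)
    have N: "?N \<le> c * ?g s r" if "r \<in> {spectral_radius A<..<s}" for r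
      using main[OF _ _ Z, of r] that by (simp add: c_def mult_ac)
    have ne: "{spectral_radius A<..<s} \<noteq> {}" using s by simp
    have "?N \<le> c * (INF r\<in>{spectral_radius A<..<s}. ?g s r)"
    proof (cases "c = 0")
      case True
      then show ?thesis using N ne by fastforce
    next
      case False
      then have "c > 0" using c0 by simp
      then have "?N / c \<le> (INF r\<in>{spectral_radius A<..<s}. ?g s r)"
        using N ne by (intro cINF_greatest) (auto simp: divide_le_eq mult.commute)
      then show ?thesis using \<open>c > 0\<close> by (simp add: divide_le_eq mult.commute)
    qed
    then show "?N \<le> entropy_const p * (INF r\<in>{spectral_radius A<..<s}. ?g s r) * entropy_quasinorm p K powr p"
      by (simp add: c_def mult_ac)
  qed
next
  fix s assume s: "s > spectral_radius A"
  define r where "r = (s + spectral_radius A) / 2"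
  have r: "spectral_radius A < r" "r < s" using s by (auto simp: r_def)
  have "s - r = (s - spectral_radius A) / 2" by (simp add: r_def field_simps)
  then have "(s - r) powr (p + 1) = ((s - spectral_radius A) / 2) powr (p + 1)" by (simp only:)
  also have "\<dots> = (s - spectral_radius A) powr (p + 1) / 2 powr (p + 1)"
    using s by (simp add: powr_divide)
  finally have half: "(s - r) powr (p + 1) = (s - spectral_radius A) powr (p + 1) / 2 powr (p + 1)" .
  have eq: "entropy_const p * (s * power_bound A r powr p / (s - r) powr (p + 1)) * entropy_quasinorm p K powr p
    = 2 powr (p + 1) * entropy_const p * (s * power_bound A r powr p / (s - spectral_radius A) powr (p + 1))
      * entropy_quasinorm p K powr p"
    unfolding half by simp
  show "eigenvalue_count (\<lambda>x. A x + K x) s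
      \<le> ennreal (2 powr (p + 1) * entropy_const p
          * (s * power_bound A ((s + spectral_radius A) / 2) powr p / (s - spectral_radius A) powr (p + 1))
          * entropy_quasinorm p K powr p)"
    using alg_mult_sum_le[OF assms r] unfolding r_def[symmetric] eq[symmetric]
    by (intro eigenvalue_count_le) auto
qed

end
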